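(* Let $m\ge1$, $n\ge1$, $N>2n$, let $\Sigma_0,\dots,\Sigma_n\in\mathbb R^{m\times m}$ and let $\mathbf T_n$ be the block-Toeplitz matrix whose $(i,j)$ block ($i,j=0,\dots,n$) is $\Sigma_{i-j}$ if $i\ge j$ and $\Sigma_{j-i}^\top$ if $i<j$. Assume there exists a symmetric positive definite $mN\times mN$ matrix $\bar{\boldsymbol\Sigma}_N$ with $E_n^\top\bar{\boldsymbol\Sigma}_NE_n=\mathbf T_n$ and $\mathbf U_N^\top\bar{\boldsymbol\Sigma}_N\mathbf U_N=\bar{\boldsymbol\Sigma}_N$. Then the function $$J(\Lambda,\Theta)=\operatorname{Tr}(\Lambda\mathbf T_n)-\log\det\left(E_n\Lambda E_n^\top+\mathbf U_N\Theta\mathbf U_N^\top-\Theta\right)$$ admits a unique minimum point $(\bar\Lambda,\bar\Theta)$ in $\mathcal L_+$.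
   Context: $\mathfrak S_k$ denotes the space of real symmetric $mk\times mk$ matrices. $E_n$ is the $mN\times m(n+1)$ matrix with $N\times(n+1)$ blocks of size $m\times m$ whose $(i,i)$ blocks ($i=1,\dots,n+1$) are $I_m$ and other blocks $0$. $\mathbf U_N$ is the $mN\times mN$ block shift matrix whose $(i,i+1)$ blocks ($i=1,\dots,N-1$) and $(N,1)$ block are $I_m$, others $0$. The linear map $A:\mathfrak S_{n+1}\times\mathfrak S_N\to\mathfrak S_N$ is $A(\Lambda,\Theta)=E_n\Lambda E_n^\top+\mathbf U_N\Theta\mathbf U_N^\top-\Theta$, and $\mathcal L_+=\{(\Lambda,\Theta)\in(\ker A)^\perp: A(\Lambda,\Theta)>0\}$, where orthogonality in $\mathfrak S_{n+1}\times\mathfrak S_N$ is with respect to the inner product $\langle(\Lambda_1,\Theta_1),(\Lambda_2,\Theta_2)\rangle=\operatorname{Tr}(\Lambda_1\Lambda_2)+\operatorname{Tr}(\Theta_1\Theta_2)$. *)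

theory Defs
  imports Complex_Main "Jordan_Normal_Form.Determinant"
begin

text \<open>Matrices are JNF matrices of type real mat with explicit dimensions.
  Indices are 0-based; block (i,j) of size m x m consists of the entries
  (r,c) with r div m = i, c div m = j.\<close>

definition mtrace :: "real mat \<Rightarrow> real" where
  "mtrace A = (\<Sum>i<dim_row A. A $$ (i, i))"

definition pos_def_mat :: "nat \<Rightarrow> real mat \<Rightarrow> bool" where
  "pos_def_mat d A \<longleftrightarrow> A \<in> carrier_mat d d \<and> A\<^sup>T = A \<and>
     (\<forall>v \<in> carrier_vec d. v \<noteq> 0\<^sub>v d \<longrightarrow> v \<bullet> (A *\<^sub>v v) > 0)"

definition symS :: "nat \<Rightarrow> nat \<Rightarrow> real mat set" where
  "symS m k = {X \<in> carrier_mat (m*k) (m*k). X\<^sup>T = X}"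

definition Emat :: "nat \<Rightarrow> nat \<Rightarrow> nat \<Rightarrow> real mat" where
  "Emat m N n = mat (m*N) (m*(n+1))
     (\<lambda>(r,c). if r div m = c div m \<and> r mod m = c mod m then 1 else 0)"

definition Umat :: "nat \<Rightarrow> nat \<Rightarrow> real mat" where
  "Umat m N = mat (m*N) (m*N)
     (\<lambda>(r,c). if c div m = (r div m + 1) mod N \<and> r mod m = c mod m then 1 else 0)"

definition Aop :: "nat \<Rightarrow> nat \<Rightarrow> nat \<Rightarrow> real mat \<times> real mat \<Rightarrow> real mat" where
  "Aop m N n p = Emat m N n * fst p * (Emat m N n)\<^sup>T
     + Umat m N * snd p * (Umat m N)\<^sup>T - snd p"

definition kerA :: "nat \<Rightarrow> nat \<Rightarrow> nat \<Rightarrow> (real mat \<times> real mat) set" where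
  "kerA m N n = {p \<in> symS m (n+1) \<times> symS m N. Aop m N n p = 0\<^sub>m (m*N) (m*N)}"

definition pair_inner :: "real mat \<times> real mat \<Rightarrow> real mat \<times> real mat \<Rightarrow> real" where
  "pair_inner p q = mtrace (fst p * fst q) + mtrace (snd p * snd q)"

definition kerA_perp :: "nat \<Rightarrow> nat \<Rightarrow> nat \<Rightarrow> (real mat \<times> real mat) set" where
  "kerA_perp m N n = {p \<in> symS m (n+1) \<times> symS m N. \<forall>q \<in> kerA m N n. pair_inner p q = 0}"

definition Lplus :: "nat \<Rightarrow> nat \<Rightarrow> nat \<Rightarrow> (real mat \<times> real mat) set" where
  "Lplus m N n = {p \<in> kerA_perp m N n. pos_def_mat (m*N) (Aop m N n p)}"

definition Tmat :: "nat \<Rightarrow> nat \<Rightarrow> (nat \<Rightarrow> real mat) \<Rightarrow> real mat" where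
  "Tmat m n \<Sigma> = mat (m*(n+1)) (m*(n+1))
     (\<lambda>(r,c). if r div m \<ge> c div m then \<Sigma> (r div m - c div m) $$ (r mod m, c mod m)
              else (\<Sigma> (c div m - r div m))\<^sup>T $$ (r mod m, c mod m))"

definition Jfun :: "nat \<Rightarrow> nat \<Rightarrow> nat \<Rightarrow> (nat \<Rightarrow> real mat) \<Rightarrow> real mat \<times> real mat \<Rightarrow> real" where
  "Jfun m N n \<Sigma> p = mtrace (fst p * Tmat m n \<Sigma>) - ln (det (Aop m N n p))"

end

theory Submission
  imports Defs "HOL-Analysis.Function_Topology"
begin

text \<open>If \<open>S\<close> is feasible, then \<open>Tr(\<Lambda> T) = Tr(A(\<Lambda>,\<Theta>) S)\<close>, so the dual functional depends on
  \<open>M = A(\<Lambda>,\<Theta>)\<close> only, through \<open>Tr(M S) - log det M\<close>, and \<open>A\<close> is injective on the orthogonal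
  complement of its kernel.  Uniqueness is strict concavity of \<open>log det\<close>, which follows from
  \<open>log det X \<le> Tr X - d\<close> with equality only at the identity; a Cholesky factor makes this the scalar
  inequality \<open>log x \<le> x - 1\<close>.  Since \<open>log det M \<le> Tr(M S)/2 + c\<close>, sublevel sets have bounded
  \<open>Tr(M S)\<close>; by compactness of the unit sphere \<open>Tr(A(p) S)\<close> dominates a multiple of the norm
  of \<open>p\<close> whenever \<open>A(p)\<close> is positive semidefinite.  Sublevel sets thus lie in a compact set on which
  \<open>det M\<close> is bounded away from zero, and the minimum is attained.\<close>

section \<open>Cholesky factorisation and the log-determinant\<close>

lemma index_mult_sum:
  fixes A B :: "'a::comm_semiring_0 mat"
  assumes "A \<in> carrier_mat a b" "B \<in> carrier_mat b c" "i < a" "j < c"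
  shows "(A * B) $$ (i,j) = (\<Sum>k<b. A $$ (i,k) * B $$ (k,j))"
  using assms by (simp add: scalar_prod_def atLeast0LessThan)

lemma quadratic_form_sum:
  fixes A :: "'a::comm_semiring_0 mat"
  assumes "A \<in> carrier_mat d d" "v \<in> carrier_vec d" "w \<in> carrier_vec d"
  shows "v \<bullet> (A *\<^sub>v w) = (\<Sum>i<d. \<Sum>j<d. v $ i * A $$ (i,j) * w $ j)"
  using assms by (simp add: scalar_prod_def atLeast0LessThan sum_distrib_left mult.assoc)

lemma symmetric_index:
  assumes "A \<in> carrier_mat d d" "A\<^sup>T = A" "i < d" "j < d"
  shows "A $$ (i,j) = A $$ (j,i)"
  using assms by (metis carrier_matD index_transpose_mat(1))

lemma pos_def_matD:
  assumes "pos_def_mat d A"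
  shows "A \<in> carrier_mat d d" "A\<^sup>T = A"
    "v \<in> carrier_vec d \<Longrightarrow> v \<noteq> 0\<^sub>v d \<Longrightarrow> v \<bullet> (A *\<^sub>v v) > 0"
  using assms by (auto simp: pos_def_mat_def)

text \<open>The left inverse \<open>H\<close> makes \<open>G\<close> injective, so a nonzero v goes
  to a nonzero \<open>G *\<^sub>v v\<close>, and the transformed form at v is the form of
  \<open>A\<close> at that vector.\<close>

lemma pos_def_mat_congruence:
  assumes A: "pos_def_mat d A" and G: "G \<in> carrier_mat d d" and H: "H \<in> carrier_mat d d"
    and HG: "H * G = 1\<^sub>m d"
  shows "pos_def_mat d (G\<^sup>T * A * G)"
proof -
  note Ac = pos_def_matD[OF A]
  have "(G\<^sup>T * A * G)\<^sup>T = G\<^sup>T * A * G"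
    using G Ac by (simp add: transpose_mult[of _ d d _ d])
  moreover have "v \<bullet> ((G\<^sup>T * A * G) *\<^sub>v v) > 0"
    if v: "v \<in> carrier_vec d" "v \<noteq> 0\<^sub>v d" for v
  proof -
    have "G *\<^sub>v v \<noteq> 0\<^sub>v d"
    proof
      assume "G *\<^sub>v v = 0\<^sub>v d"
      then have "H *\<^sub>v (G *\<^sub>v v) = 0\<^sub>v d" using H by (intro eq_vecI) auto
      then show False using HG H G v by (simp flip: assoc_mult_mat_vec)
    qed
    moreover have "v \<bullet> ((G\<^sup>T * A * G) *\<^sub>v v) = (G *\<^sub>v v) \<bullet> (A *\<^sub>v (G *\<^sub>v v))"
      using G Ac(1) v assoc_mult_mat_vec[of "G\<^sup>T" d d "A * G" d v] transpose_vec_mult_scalar[of "G\<^sup>T" d d "A *\<^sub>v (G *\<^sub>v v)" v]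
        comm_scalar_prod[of v d "G\<^sup>T *\<^sub>v (A *\<^sub>v (G *\<^sub>v v))"]
        comm_scalar_prod[of "A *\<^sub>v (G *\<^sub>v v)" d "G *\<^sub>v v"]
      by simp
    ultimately show ?thesis using Ac(3)[of "G *\<^sub>v v"] G v by simp
  qed
  ultimately show ?thesis using G Ac by (simp add: pos_def_mat_def)
qed

text \<open>The first claim evaluates the form at the first unit vector. For the second, the form of
  the Schur complement at v is the form of \<open>A\<close> at v extended by a suitable first
  coordinate.\<close>

lemma pos_def_mat_schur_complement:
  assumes A: "pos_def_mat (Suc d) A"
  shows "A $$ (0,0) > 0"
    and "pos_def_mat d (mat d d (\<lambda>(i,j). A $$ (Suc i, Suc j)
           - A $$ (Suc i, 0) * A $$ (Suc j, 0) / A $$ (0,0)))"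
proof -
  note Ac = pos_def_matD[OF A]
  let ?a = "A $$ (0,0)"
  let ?D = "mat d d (\<lambda>(i,j). A $$ (Suc i, Suc j) - A $$ (Suc i, 0) * A $$ (Suc j, 0) / ?a)"
  have "unit_vec (Suc d) 0 \<bullet> (A *\<^sub>v unit_vec (Suc d) 0) = ?a"
    using Ac(1) by (simp add: scalar_prod_left_unit)
  moreover have "unit_vec (Suc d) 0 \<noteq> (0\<^sub>v (Suc d) :: real vec)"
    by (simp add: unit_vec_nonzero)
  ultimately show a: "?a > 0" using Ac(3)[of "unit_vec (Suc d) 0"] by simp
  have "?D\<^sup>T = ?D"
    using symmetric_index[OF Ac(1,2)] by (intro eq_matI) auto
  moreover have "v \<bullet> (?D *\<^sub>v v) > 0" if v: "v \<in> carrier_vec d" "v \<noteq> 0\<^sub>v d" for v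
  proof -
    define s where "s = (\<Sum>i<d. A $$ (Suc i, 0) * v $ i)"
    \<comment> \<open>The first coordinate -s/a minimises the form of \<open>A\<close> among all
      extensions of v; the minimum is the form on the tail minus s^2/a.\<close>
    define w where "w = vec (Suc d) (\<lambda>i. if i = 0 then - s / ?a else v $ (i - 1))"
    have w: "w \<in> carrier_vec (Suc d)" by (simp add: w_def)
    obtain i where "i < d" "v $ i \<noteq> 0"
      using v by (metis carrier_vecD eq_vecI index_zero_vec(1) index_zero_vec(2))
    then have "w $ Suc i \<noteq> 0\<^sub>v (Suc d) $ Suc i" by (simp add: w_def)
    then have "w \<noteq> 0\<^sub>v (Suc d)" by metis
    then have "0 < w \<bullet> (A *\<^sub>v w)" using Ac(3) w by blast
    also have "w \<bullet> (A *\<^sub>v w) = (\<Sum>i<Suc d. \<Sum>j<Suc d. w $ i * A $$ (i,j) * w $ j)"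
      using quadratic_form_sum[OF Ac(1) w w] .
    also have "\<dots> = s\<^sup>2 / ?a - (s / ?a) * (\<Sum>j<d. A $$ (0, Suc j) * v $ j)
        - (s / ?a) * (\<Sum>i<d. A $$ (Suc i, 0) * v $ i)
        + (\<Sum>i<d. \<Sum>j<d. v $ i * A $$ (Suc i, Suc j) * v $ j)"
      using a
      by (simp add: sum.lessThan_Suc_shift w_def sum.distrib sum_distrib_left power2_eq_square
          algebra_simps sum_negf sum_subtractf del: sum.lessThan_Suc)
    also have "(\<Sum>j<d. A $$ (0, Suc j) * v $ j) = s"
      unfolding s_def using symmetric_index[OF Ac(1,2)] by (intro sum.cong) auto
    also have "(\<Sum>i<d. A $$ (Suc i, 0) * v $ i) = s" by (simp add: s_def)
    also have "s\<^sup>2 / ?a - (s / ?a) * s - (s / ?a) * s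
        + (\<Sum>i<d. \<Sum>j<d. v $ i * A $$ (Suc i, Suc j) * v $ j)
        = (\<Sum>i<d. \<Sum>j<d. v $ i * A $$ (Suc i, Suc j) * v $ j) - s * s / ?a"
      by (simp add: power2_eq_square)
    also have "s * s / ?a = (\<Sum>i<d. \<Sum>j<d. v $ i * (A $$ (Suc i, 0) * A $$ (Suc j, 0) / ?a) * v $ j)"
      unfolding s_def sum_product sum_divide_distrib
      by (intro sum.cong refl) (simp add: algebra_simps)
    also have "(\<Sum>i<d. \<Sum>j<d. v $ i * A $$ (Suc i, Suc j) * v $ j) - \<dots> = v \<bullet> (?D *\<^sub>v v)"
      using v by (subst quadratic_form_sum[of _ d])
        (auto simp: algebra_simps sum_subtractf intro!: sum.cong)
    finally show ?thesis .
  qed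
  ultimately show "pos_def_mat d ?D" by (simp add: pos_def_mat_def)
qed

text \<open>Induction on the dimension: the first column of the factor is that of \<open>A\<close>
  divided by the square root of the pivot, and the remaining block is a factor of the Schur
  complement. Triangularity and the positive diagonal make the determinant a product of positive
  squares.\<close>

lemma cholesky:
  assumes "pos_def_mat d A"
  shows "\<exists>C \<in> carrier_mat d d. A = C * C\<^sup>T \<and> (\<forall>i<d. C $$ (i,i) > 0)
           \<and> (\<forall>i j. i < j \<longrightarrow> j < d \<longrightarrow> C $$ (i,j) = 0)"
  using assms
proof (induction d arbitrary: A)
  case 0
  then show ?case by (intro bexI[of _ "0\<^sub>m 0 0"]) (auto simp: pos_def_mat_def)
next
  case (Suc d)
  note Ac = pos_def_matD[OF Suc.prems]
  let ?a = "A $$ (0,0)"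
  let ?D = "mat d d (\<lambda>(i,j). A $$ (Suc i, Suc j) - A $$ (Suc i, 0) * A $$ (Suc j, 0) / ?a)"
  note schur = pos_def_mat_schur_complement[OF Suc.prems]
  from Suc.IH[OF schur(2)] obtain C where C: "C \<in> carrier_mat d d" "?D = C * C\<^sup>T"
    "\<And>i. i < d \<Longrightarrow> C $$ (i,i) > 0" "\<And>i j. i < j \<Longrightarrow> j < d \<Longrightarrow> C $$ (i,j) = 0" by blast
  have CC: "(\<Sum>k<d. C $$ (i,k) * C $$ (j,k)) = A $$ (Suc i, Suc j) - A $$ (Suc i, 0) * A $$ (Suc j, 0) / ?a"
    if "i < d" "j < d" for i j
  proof -
    have "(\<Sum>k<d. C $$ (i,k) * C $$ (j,k)) = (C * C\<^sup>T) $$ (i,j)"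
      using that C(1) by (subst index_mult_sum[of _ d d]) (auto intro!: sum.cong)
    then show ?thesis using that by (simp flip: C(2))
  qed
  define L where "L = mat (Suc d) (Suc d) (\<lambda>(i,j). if j = 0 then A $$ (i,0) / sqrt ?a
    else if i = 0 then 0 else C $$ (i - 1, j - 1))"
  have L: "L \<in> carrier_mat (Suc d) (Suc d)" by (simp add: L_def)
  have "A = L * L\<^sup>T"
  proof (intro eq_matI)
    fix i j assume "i < dim_row (L * L\<^sup>T)" "j < dim_col (L * L\<^sup>T)"
    then have ij: "i < Suc d" "j < Suc d" by (auto simp: L_def)
    have "(L * L\<^sup>T) $$ (i,j) = (\<Sum>k<Suc d. L $$ (i,k) * L $$ (j,k))"
      using ij L by (subst index_mult_sum[of _ "Suc d" "Suc d"]) (auto intro!: sum.cong)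
    also have "\<dots> = A $$ (i,0) * A $$ (j,0) / ?a + (\<Sum>k<d. L $$ (i,Suc k) * L $$ (j,Suc k))"
      using ij schur(1)
      by (simp add: sum.lessThan_Suc_shift L_def del: sum.lessThan_Suc)
    also have "\<dots> = A $$ (i,j)"
    proof (cases "i = 0 \<or> j = 0")
      case True
      then have "(\<Sum>k<d. L $$ (i,Suc k) * L $$ (j,Suc k)) = 0"
        using ij by (auto simp: L_def)
      then show ?thesis
        using True schur(1) symmetric_index[OF Ac(1,2) ij] by auto
    next
      case False
      then obtain i' j' where [simp]: "i = Suc i'" "j = Suc j'" by (metis not0_implies_Suc)
      have "(\<Sum>k<d. L $$ (i,Suc k) * L $$ (j,Suc k)) = (\<Sum>k<d. C $$ (i',k) * C $$ (j',k))"
        using ij by (intro sum.cong) (auto simp: L_def)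
      then show ?thesis using CC[of i' j'] ij by simp
    qed
    finally show "A $$ (i,j) = (L * L\<^sup>T) $$ (i,j)" by simp
  qed (use Ac(1) L in auto)
  moreover have "L $$ (i,i) > 0" if "i < Suc d" for i
    using that schur(1) C(3)[of "i - 1"] by (auto simp: L_def)
  moreover have "L $$ (i,j) = 0" if "i < j" "j < Suc d" for i j
    using that C(4)[of "i - 1" "j - 1"] by (auto simp: L_def)
  ultimately show ?case using L by blast
qed

lemma det_cholesky:
  fixes C :: "real mat"
  assumes C: "C \<in> carrier_mat d d" and low: "\<forall>i j. i < j \<longrightarrow> j < d \<longrightarrow> C $$ (i,j) = 0"
  shows "det (C * C\<^sup>T) = (\<Prod>i<d. (C $$ (i,i))\<^sup>2)"
proof -
  have "det C = (\<Prod>i<d. C $$ (i,i))"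
    using det_lower_triangular[of d C] low C by (simp add: prod_list_diag_prod atLeast0LessThan)
  moreover have "det (C * C\<^sup>T) = det C * det C"
    using C det_mult[of C d "C\<^sup>T"] det_transpose[OF C] by simp
  ultimately show ?thesis by (simp add: power2_eq_square prod.distrib)
qed

lemma pos_def_mat_det_pos:
  assumes "pos_def_mat d A"
  shows "det A > 0"
proof -
  obtain C where C: "C \<in> carrier_mat d d" "A = C * C\<^sup>T" "\<forall>i<d. C $$ (i,i) > 0"
    "\<forall>i j. i < j \<longrightarrow> j < d \<longrightarrow> C $$ (i,j) = 0" using cholesky[OF assms] by blast
  show ?thesis
    unfolding C(2) det_cholesky[OF C(1,4)] using C(3) by (intro prod_pos) force
qed

text \<open>The form of the factorisation that the congruence arguments use: no triangularity, but
  an explicit two-sided inverse of the factor.\<close>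

lemma pos_def_mat_factor:
  assumes "pos_def_mat d A"
  obtains C G where "C \<in> carrier_mat d d" "G \<in> carrier_mat d d" "A = C * C\<^sup>T"
    "C * G = 1\<^sub>m d" "G * C = 1\<^sub>m d"
proof -
  obtain C where C: "C \<in> carrier_mat d d" "A = C * C\<^sup>T" using cholesky[OF assms] by blast
  have "det A = det C * det C"
    using C det_mult[of C d "C\<^sup>T"] det_transpose[OF C(1)] by simp
  then have "det C \<noteq> 0" using pos_def_mat_det_pos[OF assms] by auto
  then obtain G where "G \<in> carrier_mat d d" "C * G = 1\<^sub>m d" "G * C = 1\<^sub>m d"
    using det_non_zero_imp_unit[OF C(1), of "()"] by (auto simp: Units_def ring_mat_def)
  with C that show ?thesis by blast
qed

text \<open>With a Cholesky factor C, log det is the sum of the logarithms of the squared diagonal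
  entries of C, whereas the trace is the sum of the squares of all its entries. The inequality ln x
  \<le> x - 1 is applied to each diagonal square; equality forces C to be the identity.\<close>

lemma ln_det_le_trace:
  assumes "pos_def_mat d A"
  shows "ln (det A) \<le> mtrace A - d"
    and "ln (det A) = mtrace A - d \<Longrightarrow> A = 1\<^sub>m d"
proof -
  obtain C where C: "C \<in> carrier_mat d d" "A = C * C\<^sup>T" "\<And>i. i < d \<Longrightarrow> C $$ (i,i) > 0"
    "\<forall>i j. i < j \<longrightarrow> j < d \<longrightarrow> C $$ (i,j) = 0" using cholesky[OF assms] by blast
  have det: "ln (det A) = (\<Sum>i<d. ln ((C $$ (i,i))\<^sup>2))"
    unfolding C(2) det_cholesky[OF C(1,4)] using C(3) by (intro ln_prod) (force simp: less_imp_neq[symmetric])+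
  have tr: "mtrace A = (\<Sum>i<d. \<Sum>k<d. (C $$ (i,k))\<^sup>2)"
    using C(1,2) unfolding mtrace_def
    by (auto simp: scalar_prod_def atLeast0LessThan power2_eq_square intro!: sum.cong)
  \<comment> \<open>Keeping the off-diagonal squares of the row as the lower bound, rather than 0,
    is what later makes them vanish in the equality case.\<close>
  have le: "(\<Sum>k<d. (C $$ (i,k))\<^sup>2) - 1 - ln ((C $$ (i,i))\<^sup>2)
      \<ge> (\<Sum>k\<in>{..<d} - {i}. (C $$ (i,k))\<^sup>2)" if "i < d" for i
  proof -
    have "ln ((C $$ (i,i))\<^sup>2) \<le> (C $$ (i,i))\<^sup>2 - 1"
      using C(3)[OF that] by (intro ln_le_minus_one) simp
    then show ?thesis using that by (subst sum.remove[of _ i]) auto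
  qed
  have diff: "mtrace A - d - ln (det A)
      = (\<Sum>i<d. (\<Sum>k<d. (C $$ (i,k))\<^sup>2) - 1 - ln ((C $$ (i,i))\<^sup>2))"
    unfolding det tr by (simp add: sum_subtractf)
  have nonneg: "(\<Sum>k<d. (C $$ (i,k))\<^sup>2) - 1 - ln ((C $$ (i,i))\<^sup>2) \<ge> 0" if "i < d" for i
    using le[OF that] sum_nonneg[of "{..<d} - {i}" "\<lambda>k. (C $$ (i,k))\<^sup>2"] by simp
  then have "mtrace A - d - ln (det A) \<ge> 0" unfolding diff by (intro sum_nonneg) auto
  then show "ln (det A) \<le> mtrace A - d" by simp
  assume "ln (det A) = mtrace A - d"
  then have "(\<Sum>i<d. (\<Sum>k<d. (C $$ (i,k))\<^sup>2) - 1 - ln ((C $$ (i,i))\<^sup>2)) = 0"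
    using diff by simp
  then have zero: "(\<Sum>k<d. (C $$ (i,k))\<^sup>2) - 1 - ln ((C $$ (i,i))\<^sup>2) = 0" if "i < d" for i
    using that nonneg by (subst (asm) sum_nonneg_eq_0_iff) auto
  have off: "C $$ (i,k) = 0" if "i < d" "k < d" "i \<noteq> k" for i k
  proof -
    have "(\<Sum>k\<in>{..<d} - {i}. (C $$ (i,k))\<^sup>2) = 0"
      using le[OF that(1)] zero[OF that(1)] sum_nonneg[of "{..<d} - {i}" "\<lambda>k. (C $$ (i,k))\<^sup>2"]
      by simp
    then show ?thesis using that by (subst (asm) sum_nonneg_eq_0_iff) auto
  qed
  have "C $$ (i,i) = 1" if "i < d" for i
  proof -
    have "(\<Sum>k<d. (C $$ (i,k))\<^sup>2) = (C $$ (i,i))\<^sup>2"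
      using that off by (subst sum.remove[of _ i]) auto
    then have "ln ((C $$ (i,i))\<^sup>2) = (C $$ (i,i))\<^sup>2 - 1" using zero[OF that] by simp
    then have "(C $$ (i,i))\<^sup>2 = 1" using C(3)[OF that] by (intro ln_eq_minus_one) auto
    then show ?thesis using C(3)[OF that] by (simp add: power2_eq_1_iff)
  qed
  with off have "C = 1\<^sub>m d" using C(1) by (intro eq_matI) auto
  then show "A = 1\<^sub>m d" using C(2) by simp
qed

section \<open>Traces and positive semidefinite matrices\<close>

lemma mtrace_mult:
  assumes "A \<in> carrier_mat a b" "B \<in> carrier_mat b a"
  shows "mtrace (A * B) = (\<Sum>i<a. \<Sum>j<b. A $$ (i,j) * B $$ (j,i))"
  using assms unfolding mtrace_def
  by (auto simp: scalar_prod_def atLeast0LessThan intro!: sum.cong)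

lemma mtrace_mult_commute:
  assumes "A \<in> carrier_mat a b" "B \<in> carrier_mat b a"
  shows "mtrace (A * B) = mtrace (B * A)"
  unfolding mtrace_mult[OF assms] mtrace_mult[OF assms(2,1)]
  by (subst sum.swap) (simp add: mult.commute)

lemma mtrace_linear:
  assumes "A \<in> carrier_mat d d" "B \<in> carrier_mat d d"
  shows "mtrace (A + B) = mtrace A + mtrace B" "mtrace (A - B) = mtrace A - mtrace B"
    "mtrace (c \<cdot>\<^sub>m A) = c * mtrace A"
  using assms by (simp_all add: mtrace_def sum.distrib sum_subtractf sum_distrib_left)

text \<open>The closed counterpart of \<open>pos_def_mat\<close>: defined by weak inequalities, it
  can cut out compact sets, and a nonzero determinant leads back to positive definiteness.\<close>

definition psd_mat :: "nat \<Rightarrow> real mat \<Rightarrow> bool" where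
  "psd_mat d A \<longleftrightarrow> A \<in> carrier_mat d d \<and> A\<^sup>T = A \<and> (\<forall>v \<in> carrier_vec d. v \<bullet> (A *\<^sub>v v) \<ge> 0)"

lemma pos_def_imp_psd: "pos_def_mat d A \<Longrightarrow> psd_mat d A"
  unfolding pos_def_mat_def psd_mat_def by (metis order.order_iff_strict scalar_prod_left_zero
    mult_mat_vec_carrier zero_carrier_vec)

lemma quadratic_form_commute:
  fixes A :: "real mat"
  assumes "A \<in> carrier_mat d d" "A\<^sup>T = A" "v \<in> carrier_vec d" "w \<in> carrier_vec d"
  shows "v \<bullet> (A *\<^sub>v w) = w \<bullet> (A *\<^sub>v v)"
  using assms transpose_vec_mult_scalar[of A d d w v]
    comm_scalar_prod[of "A *\<^sub>v v" d w] by simp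

text \<open>The first-order condition at a minimum: a quadratic polynomial that vanishes at 0 and is
  nowhere negative has zero slope there.\<close>

lemma linear_term_zero:
  fixes b c :: real
  assumes pos: "\<And>t. 2 * t * b + t\<^sup>2 * c \<ge> 0"
  shows "b = 0"
proof (rule ccontr)
  assume "b \<noteq> 0"
  \<comment> \<open>At t = -b*u the polynomial equals b^2 * u * (c*u - 2); this u is small enough to
    make the last factor negative.\<close>
  define u where "u = 1 / (\<bar>c\<bar> + 1)"
  have u: "u > 0" "c * u < 2" by (auto simp: u_def field_simps)
  have "2 * (- b * u) * b + (- b * u)\<^sup>2 * c = (b\<^sup>2 * u) * (c * u - 2)"
    by (simp add: algebra_simps power2_eq_square)
  also have "\<dots> < 0" using \<open>b \<noteq> 0\<close> u by (intro mult_pos_neg) auto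
  finally show False using pos[of "- b * u"] by simp
qed

text \<open>The vector v minimises the form, so the derivative at v in the direction w = A v
  vanishes; by symmetry of \<open>A\<close> it equals twice the squared norm of w.\<close>

lemma psd_mat_kernel:
  assumes A: "psd_mat d A" and v: "v \<in> carrier_vec d" and zero: "v \<bullet> (A *\<^sub>v v) = 0"
  shows "A *\<^sub>v v = 0\<^sub>v d"
proof -
  have Ac: "A \<in> carrier_mat d d" "A\<^sup>T = A" and nn: "\<And>v. v \<in> carrier_vec d \<Longrightarrow> v \<bullet> (A *\<^sub>v v) \<ge> 0"
    using A by (auto simp: psd_mat_def)
  define w where "w = A *\<^sub>v v"
  have w: "w \<in> carrier_vec d" using Ac v by (simp add: w_def)
  define q where "q = w \<bullet> (A *\<^sub>v w)"
  have expand: "(v + t \<cdot>\<^sub>v w) \<bullet> (A *\<^sub>v (v + t \<cdot>\<^sub>v w)) = 2 * t * (w \<bullet> w) + t\<^sup>2 * q" for t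
    using Ac v w zero quadratic_form_commute[OF Ac v w]
    by (simp add: mult_add_distrib_mat_vec[of _ d d] mult_mat_vec[of _ d d] q_def
        scalar_prod_add_distrib[of _ d] add_scalar_prod_distrib[of _ d] w_def[symmetric]
        power2_eq_square algebra_simps)
  have pos: "2 * t * (w \<bullet> w) + t\<^sup>2 * q \<ge> 0" for t
    using nn[of "v + t \<cdot>\<^sub>v w"] v w unfolding expand by simp
  have "w \<bullet> w = 0" by (rule linear_term_zero[OF pos])
  moreover have "w \<bullet> w = (\<Sum>i<d. (w $ i)\<^sup>2)"
    using w by (simp add: scalar_prod_def atLeast0LessThan power2_eq_square)
  ultimately have "(\<Sum>i<d. (w $ i)\<^sup>2) = 0" by simp
  then have "w $ i = 0" if "i < d" for i
    using that by (subst (asm) sum_nonneg_eq_0_iff) auto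
  with w show ?thesis unfolding w_def[symmetric] by (intro eq_vecI) auto
qed

text \<open>A nonzero vector at which the form vanishes would lie in the kernel of \<open>A\<close>,
  contradicting the nonzero determinant.\<close>

lemma psd_mat_det_nonzero:
  assumes A: "psd_mat d A" and "det A \<noteq> 0"
  shows "pos_def_mat d A"
  using assms psd_mat_kernel[OF A] det_0_iff_vec_prod_zero[of A d]
  unfolding psd_mat_def pos_def_mat_def by (metis order_less_le)

lemma trace_congruence:
  assumes M: "M \<in> carrier_mat d d" and C: "C \<in> carrier_mat d d"
  shows "mtrace (C\<^sup>T * M * C) = mtrace (M * (C * C\<^sup>T))"
  using assms mtrace_mult_commute[of "C\<^sup>T" d d "M * C"] by simp

text \<open>Writing S = C C^T turns the trace into the sum of the values of the form of
  \<open>M\<close> at the columns of C. If the sum is zero, \<open>M\<close> annihilates every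
  column, and C is invertible.\<close>

lemma trace_psd_mult:
  assumes M: "psd_mat d M" and S: "pos_def_mat d S"
  shows "mtrace (M * S) \<ge> 0" and "mtrace (M * S) = 0 \<Longrightarrow> M = 0\<^sub>m d d"
proof -
  obtain C G where C: "C \<in> carrier_mat d d" "G \<in> carrier_mat d d" "S = C * C\<^sup>T"
    "C * G = 1\<^sub>m d" using pos_def_mat_factor[OF S] by metis
  have Mc: "M \<in> carrier_mat d d" and nn: "\<And>v. v \<in> carrier_vec d \<Longrightarrow> v \<bullet> (M *\<^sub>v v) \<ge> 0"
    using M by (auto simp: psd_mat_def)
  have tr: "mtrace (M * S) = (\<Sum>i<d. col C i \<bullet> (M *\<^sub>v col C i))"
    using C(1) Mc unfolding C(3) trace_congruence[OF Mc C(1), symmetric]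
    by (auto simp: mtrace_def mult_mat_vec_def assoc_mult_mat[of _ d d] intro!: sum.cong)
  have nonneg: "col C i \<bullet> (M *\<^sub>v col C i) \<ge> 0" if "i < d" for i
    using nn C(1) that by (simp add: carrier_matD)
  show "mtrace (M * S) \<ge> 0" unfolding tr using nonneg by (intro sum_nonneg) auto
  assume "mtrace (M * S) = 0"
  then have "col C i \<bullet> (M *\<^sub>v col C i) = 0" if "i < d" for i
    using that nonneg unfolding tr by (subst (asm) sum_nonneg_eq_0_iff) auto
  then have "M *\<^sub>v col C i = 0\<^sub>v d" if "i < d" for i
    using psd_mat_kernel[OF M, of "col C i"] C(1) that by (simp add: carrier_matD)
  then have cols: "col (M * C) i = 0\<^sub>v d" if "i < d" for i
    using that C(1) Mc by (metis col_mult2)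
  have "M * C = 0\<^sub>m d d"
  proof (intro eq_matI)
    fix i j assume ij: "i < dim_row (0\<^sub>m d d :: real mat)" "j < dim_col (0\<^sub>m d d :: real mat)"
    then have "(M * C) $$ (i,j) = col (M * C) j $ i" using C(1) Mc by simp
    then show "(M * C) $$ (i,j) = 0\<^sub>m d d $$ (i,j)" using cols[of j] ij by simp
  qed (use C(1) Mc in auto)
  then have "M * C * G = 0\<^sub>m d d" using C by simp
  then show "M = 0\<^sub>m d d" using C(1,2,4) Mc by simp
qed

section \<open>The log-determinant: congruence, linear upper bound, strict midpoint
  concavity\<close>

lemma ln_det_congruence:
  assumes M: "pos_def_mat d M" and C: "C \<in> carrier_mat d d" "G \<in> carrier_mat d d"
    "G * C = 1\<^sub>m d"
  shows "ln (det (C\<^sup>T * M * C)) = ln (det (C * C\<^sup>T)) + ln (det M)"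
proof -
  have Mc: "M \<in> carrier_mat d d" using M by (simp add: pos_def_mat_def)
  have "det G * det C = 1" using C by (metis det_mult det_one)
  then have "det C \<noteq> 0" by auto
  moreover have CC: "det (C * C\<^sup>T) = det C * det C"
    using C(1) det_mult[of C d "C\<^sup>T"] det_transpose[OF C(1)] by simp
  ultimately have pos: "det (C * C\<^sup>T) > 0" by (simp add: zero_less_mult_iff neq_iff disj_commute)
  have "det (C\<^sup>T * M * C) = det (C * C\<^sup>T) * det M"
    unfolding CC using C(1) Mc det_mult[of "C\<^sup>T" d "M * C"] det_mult[OF Mc C(1)] det_transpose[OF C(1)]
    by simp
  then show "ln (det (C\<^sup>T * M * C)) = ln (det (C * C\<^sup>T)) + ln (det M)"
    using pos pos_def_mat_det_pos[OF M] by (simp add: ln_mult)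
qed

lemma pos_def_mat_smult:
  assumes "pos_def_mat d A" "c > 0"
  shows "pos_def_mat d (c \<cdot>\<^sub>m A)"
proof -
  have A: "A \<in> carrier_mat d d" "A\<^sup>T = A" using pos_def_matD[OF assms(1)] by blast+
  have "(c \<cdot>\<^sub>m A)\<^sup>T = c \<cdot>\<^sub>m A"
    using A symmetric_index[OF A] by (intro eq_matI) auto
  moreover have "v \<bullet> ((c \<cdot>\<^sub>m A) *\<^sub>v v) = c * (v \<bullet> (A *\<^sub>v v))" if "v \<in> carrier_vec d" for v
    using A that by (simp add: quadratic_form_sum[of _ d] sum_distrib_left algebra_simps)
  ultimately show ?thesis using assms A unfolding pos_def_mat_def by simp
qed

lemma pos_def_mat_add:
  assumes "pos_def_mat d A" "pos_def_mat d B"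
  shows "pos_def_mat d (A + B)"
  using assms unfolding pos_def_mat_def
  by (auto simp: transpose_add[of _ d d] add_mult_distrib_mat_vec[of _ d d]
      scalar_prod_add_distrib[of _ d] intro!: add_pos_pos)

text \<open>The bound log det X \<le> Tr X - d is applied to X = C^T (M/2) C with S = C C^T. Halving
  \<open>M\<close> costs only the constant d * ln 2 and leaves half of Tr(M S) to control the
  functional from below.\<close>

lemma ln_det_le_half_trace:
  assumes S: "pos_def_mat d S"
  shows "\<exists>c. \<forall>M. pos_def_mat d M \<longrightarrow> ln (det M) \<le> mtrace (M * S) / 2 + c"
proof -
  obtain C G where C: "C \<in> carrier_mat d d" "G \<in> carrier_mat d d" "S = C * C\<^sup>T"
    "G * C = 1\<^sub>m d" using pos_def_mat_factor[OF S] by metis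
  have "ln (det M) \<le> mtrace (M * S) / 2 + (d * ln 2 - d - ln (det S))" if M: "pos_def_mat d M" for M
  proof -
    let ?H = "(1/2) \<cdot>\<^sub>m M"
    have Mc: "M \<in> carrier_mat d d" using M by (simp add: pos_def_mat_def)
    have H: "pos_def_mat d ?H" using pos_def_mat_smult[OF M] by simp
    have "ln (det ?H) = ln (det M) - d * ln 2"
      using Mc pos_def_mat_det_pos[OF M]
      by (simp add: det_smult ln_mult ln_realpow ln_div power_one_over)
    moreover have "mtrace (?H * S) = mtrace (M * S) / 2"
      using Mc C(1) unfolding C(3)
      by (simp add: mult_smult_assoc_mat[of M d d _ d] mtrace_linear(3)[of "M * (C * C\<^sup>T)" d])
    ultimately show ?thesis
      using ln_det_le_trace(1)[OF pos_def_mat_congruence[OF H C(1,2,4)]]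
        ln_det_congruence(1)[OF H C(1,2,4)] trace_congruence[of ?H d C] Mc C
      by simp
  qed
  then show ?thesis by blast
qed

text \<open>A congruence takes the midpoint to the identity. The images X and Y of \<open>M\<close>
  and \<open>K\<close> then have traces adding up to 2d, so the two trace bounds add up to log det X
  + log det Y \<le> 0. The inequality is strict because X and Y cannot both be the identity when
  \<open>M\<close> and \<open>K\<close> differ.\<close>

lemma ln_det_midpoint_less:
  assumes M: "pos_def_mat d M" and K: "pos_def_mat d K" and "M \<noteq> K"
  shows "ln (det M) + ln (det K) < 2 * ln (det ((1/2) \<cdot>\<^sub>m (M + K)))"
proof -
  let ?R = "(1/2) \<cdot>\<^sub>m (M + K)"
  have Mc: "M \<in> carrier_mat d d" "K \<in> carrier_mat d d" using M K by (auto simp: pos_def_mat_def)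
  have R: "pos_def_mat d ?R" by (intro pos_def_mat_smult pos_def_mat_add M K) simp
  obtain D G where D: "D \<in> carrier_mat d d" "G \<in> carrier_mat d d" "?R = D * D\<^sup>T"
    "D * G = 1\<^sub>m d" "G * D = 1\<^sub>m d" using pos_def_mat_factor[OF R] by metis
  \<comment> \<open>This is the inverse transpose of D, so that C^T (D D^T) C is the
    identity.\<close>
  define C where "C = G\<^sup>T"
  have DC: "D\<^sup>T * C = 1\<^sub>m d" and CD: "C * D\<^sup>T = 1\<^sub>m d"
    unfolding C_def transpose_mult[OF D(2,1), symmetric] transpose_mult[OF D(1,2), symmetric] D(4,5)
    by simp_all
  have C: "C \<in> carrier_mat d d" "D\<^sup>T \<in> carrier_mat d d" "D\<^sup>T * C = 1\<^sub>m d"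
    and CT: "C\<^sup>T = G"
    using D(1,2) DC by (auto simp: C_def)
  \<comment> \<open>The congruence by C is undone by multiplying with D on the left and its
    transpose on the right.\<close>
  have inj: "A = B" if "C\<^sup>T * A * C = C\<^sup>T * B * C" "A \<in> carrier_mat d d" "B \<in> carrier_mat d d" for A B
  proof -
    have *: "D * (C\<^sup>T * X * C) * D\<^sup>T = X" if X: "X \<in> carrier_mat d d" for X
    proof -
      have "D * (C\<^sup>T * X * C) * D\<^sup>T = D * (G * (X * (C * D\<^sup>T)))"
        using X D(1,2) C(1,2) CT by (simp add: assoc_mult_mat[of _ d d _ d _ d])
      also have "\<dots> = (D * G) * (X * (C * D\<^sup>T))"
        using X D(1,2) C(1,2) by (intro assoc_mult_mat[symmetric]) auto
      finally show ?thesis using X D(4) CD by simp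
    qed
    have "A = D * (C\<^sup>T * A * C) * D\<^sup>T" using *[OF that(2)] by (rule sym)
    also have "\<dots> = D * (C\<^sup>T * B * C) * D\<^sup>T" by (simp only: that(1))
    also have "\<dots> = B" by (rule *[OF that(3)])
    finally show ?thesis .
  qed
  let ?X = "C\<^sup>T * M * C" and ?Y = "C\<^sup>T * K * C"
  have X: "pos_def_mat d ?X" and Y: "pos_def_mat d ?Y"
    using pos_def_mat_congruence[OF _ C] M K by auto
  have one: "C\<^sup>T * ?R * C = 1\<^sub>m d"
  proof -
    have "C\<^sup>T * ?R * C = G * (D * (D\<^sup>T * C))"
      unfolding D(3) using D(1,2) C(1,2) CT by (simp add: assoc_mult_mat[of _ d d _ d _ d])
    also have "\<dots> = (G * D) * (D\<^sup>T * C)"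
      using D(1,2) C(1,2) by (intro assoc_mult_mat[symmetric]) auto
    finally show ?thesis using DC D(5) by simp
  qed
  have "mtrace (C\<^sup>T * ?R * C) = d" unfolding one by (simp add: mtrace_def)
  moreover have "C\<^sup>T * ?R * C = (1/2) \<cdot>\<^sub>m (?X + ?Y)"
    using Mc C(1)
    by (simp add: mult_smult_distrib[of _ d d _ d] mult_smult_assoc_mat[of _ d d _ d]
        mult_add_distrib_mat[of _ d d _ d] add_mult_distrib_mat[of _ d d _ _ d])
  ultimately have tr: "mtrace ?X + mtrace ?Y = 2 * d"
    using Mc C(1) by (simp add: mtrace_linear[of _ d])
  have "\<not> (?X = 1\<^sub>m d \<and> ?Y = 1\<^sub>m d)" using inj Mc \<open>M \<noteq> K\<close> by metis
  then have "ln (det ?X) + ln (det ?Y) < mtrace ?X - d + (mtrace ?Y - d)"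
    using ln_det_le_trace[OF X] ln_det_le_trace[OF Y] by fastforce
  \<comment> \<open>The midpoint becomes the identity, whose log det is 0; the constant contributed
    by the congruence is therefore minus log det of the midpoint.\<close>
  moreover have "ln (det (C * C\<^sup>T)) + ln (det ?R) = 0"
    using ln_det_congruence(1)[OF R C] one by simp
  ultimately show ?thesis
    using tr ln_det_congruence(1)[OF M C] ln_det_congruence(1)[OF K C] by simp
qed

section \<open>Continuity and compactness for matrices\<close>

text \<open>Continuity is entrywise, and the dimensions are the same at every point, so that
  products, traces and determinants are finite sums over fixed index ranges.\<close>

definition cont_mat :: "nat \<Rightarrow> nat \<Rightarrow> ('x::topological_space \<Rightarrow> real mat) \<Rightarrow> bool" where
  "cont_mat a b F \<longleftrightarrow> (\<forall>x. F x \<in> carrier_mat a b) \<and>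
     (\<forall>i<a. \<forall>j<b. continuous_on UNIV (\<lambda>x. F x $$ (i,j)))"

lemma cont_matD:
  assumes "cont_mat a b F"
  shows "F x \<in> carrier_mat a b" "dim_row (F x) = a" "dim_col (F x) = b"
    "i < a \<Longrightarrow> j < b \<Longrightarrow> continuous_on UNIV (\<lambda>x. F x $$ (i,j))"
  using assms by (auto simp: cont_mat_def)

lemma cont_mat_const: "A \<in> carrier_mat a b \<Longrightarrow> cont_mat a b (\<lambda>x. A)"
  by (simp add: cont_mat_def)

lemma cont_matI:
  assumes "\<And>x. F x \<in> carrier_mat a b"
    and "\<And>i j. i < a \<Longrightarrow> j < b \<Longrightarrow> continuous_on UNIV (\<lambda>x. F x $$ (i,j))"
  shows "cont_mat a b F"
  using assms by (simp add: cont_mat_def)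

lemma cont_mat_add:
  assumes F: "cont_mat a b F" and G: "cont_mat a b G"
  shows "cont_mat a b (\<lambda>x. F x + G x)"
proof (rule cont_matI)
  show "continuous_on UNIV (\<lambda>x. (F x + G x) $$ (i,j))" if "i < a" "j < b" for i j
    using continuous_on_add[OF cont_matD(4)[OF F that] cont_matD(4)[OF G that]] that
    by (simp add: cont_matD(2,3)[OF G])
qed (rule add_carrier_mat[OF cont_matD(1)[OF G]])

lemma cont_mat_diff:
  assumes F: "cont_mat a b F" and G: "cont_mat a b G"
  shows "cont_mat a b (\<lambda>x. F x - G x)"
proof (rule cont_matI)
  show "continuous_on UNIV (\<lambda>x. (F x - G x) $$ (i,j))" if "i < a" "j < b" for i j
    using continuous_on_diff[OF cont_matD(4)[OF F that] cont_matD(4)[OF G that]] that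
    by (simp add: cont_matD(2,3)[OF G])
qed (rule minus_carrier_mat[OF cont_matD(1)[OF G]])

lemma cont_mat_mult:
  assumes F: "cont_mat a b F" and G: "cont_mat b c G"
  shows "cont_mat a c (\<lambda>x. F x * G x)"
proof (rule cont_matI)
  fix i j assume ij: "i < a" "j < c"
  have "continuous_on UNIV (\<lambda>x. \<Sum>k<b. F x $$ (i,k) * G x $$ (k,j))"
    using ij by (intro continuous_on_sum continuous_on_mult cont_matD(4)[OF F] cont_matD(4)[OF G]) auto
  then show "continuous_on UNIV (\<lambda>x. (F x * G x) $$ (i,j))"
    by (simp only: index_mult_sum[OF cont_matD(1)[OF F] cont_matD(1)[OF G] ij])
qed (rule mult_carrier_mat[OF cont_matD(1)[OF F] cont_matD(1)[OF G]])

lemma cont_mat_transpose: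
  assumes F: "cont_mat a b F"
  shows "cont_mat b a (\<lambda>x. (F x)\<^sup>T)"
proof (rule cont_matI)
  show "continuous_on UNIV (\<lambda>x. (F x)\<^sup>T $$ (i,j))" if "i < b" "j < a" for i j
    using cont_matD(4)[OF F that(2,1)] that by (simp add: cont_matD(2,3)[OF F])
qed (simp add: cont_matD(1)[OF F])

lemma continuous_on_mtrace:
  assumes F: "cont_mat a a F"
  shows "continuous_on UNIV (\<lambda>x. mtrace (F x))"
  unfolding mtrace_def cont_matD(2)[OF F]
  by (intro continuous_on_sum cont_matD(4)[OF F]) auto

text \<open>The Leibniz formula exhibits the determinant as a polynomial in the entries.\<close>

lemma continuous_on_det:
  assumes F: "cont_mat a a F"
  shows "continuous_on UNIV (\<lambda>x. det (F x))"
proof -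
  have "det (F x) = (\<Sum>p | p permutes {0..<a}. signof p * (\<Prod>i = 0..<a. F x $$ (i, p i)))" for x
    using det_def'[OF cont_matD(1)[OF F]] .
  moreover have "continuous_on UNIV (\<lambda>x. F x $$ (i, p i))" if "p permutes {0..<a}" "i < a" for p i
    using that permutes_in_image[of p "{0..<a}" i] by (intro cont_matD[OF F]) auto
  ultimately show ?thesis
    by (simp only:) (intro continuous_on_sum continuous_on_mult continuous_on_const continuous_on_prod; simp)
qed

lemma closed_mat_eq:
  assumes F: "cont_mat a b F" and G: "cont_mat a b G"
  shows "closed {x. F x = G x}"
proof -
  have "{x. F x = G x} = (\<Inter>i\<in>{..<a}. \<Inter>j\<in>{..<b}. {x. F x $$ (i,j) = G x $$ (i,j)})"
    by (auto simp: cont_matD(2,3)[OF F] cont_matD(2,3)[OF G] intro!: eq_matI)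
  also have "closed \<dots>"
    by (intro closed_INT ballI closed_Collect_eq cont_matD(4)[OF F] cont_matD(4)[OF G]) auto
  finally show ?thesis .
qed

text \<open>Each test vector contributes one weak inequality between continuous functions, and an
  arbitrary intersection of closed sets is closed.\<close>

lemma closed_psd_mat:
  assumes F: "cont_mat d d F"
  shows "closed {x. psd_mat d (F x)}"
proof -
  have "{x. psd_mat d (F x)} = {x. (F x)\<^sup>T = F x}
      \<inter> (\<Inter>v\<in>carrier_vec d. {x. 0 \<le> (\<Sum>i<d. \<Sum>j<d. v $ i * F x $$ (i,j) * v $ j)})"
    by (auto simp: psd_mat_def cont_matD(1)[OF F] quadratic_form_sum[OF cont_matD(1)[OF F]])
  also have "closed \<dots>"
    by (intro closed_Int closed_mat_eq[OF cont_mat_transpose[OF F] F] closed_INT ballI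
        closed_Collect_le continuous_on_const continuous_on_sum continuous_on_mult cont_matD(4)[OF F]) auto
  finally show ?thesis .
qed

text \<open>The type \<^typ>\<open>real mat\<close> carries no topology; square matrices of fixed sizes are
  coordinatised by functions, whose product topology provides Tychonoff compactness.\<close>

definition mat_pair :: "nat \<Rightarrow> nat \<Rightarrow> (nat \<times> nat \<Rightarrow> real) \<times> (nat \<times> nat \<Rightarrow> real) \<Rightarrow> real mat \<times> real mat"
  where "mat_pair a b x = (mat a a (fst x), mat b b (snd x))"

lemma cont_mat_pair:
  "cont_mat a a (\<lambda>x. fst (mat_pair a b x))" "cont_mat b b (\<lambda>x. snd (mat_pair a b x))"
  by (auto simp: cont_mat_def mat_pair_def
      intro!: continuous_on_product_then_coordinatewise continuous_on_fst continuous_on_snd continuous_on_id)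

lemma compact_box_fun: "compact {f :: 'i \<Rightarrow> real. \<forall>i. \<bar>f i\<bar> \<le> R}"
proof -
  have "{f :: 'i \<Rightarrow> real. \<forall>i. \<bar>f i\<bar> \<le> R} = PiE UNIV (\<lambda>_. {-R..R})"
    by (auto simp: PiE_def Pi_def abs_le_iff minus_le_iff)
  moreover have "compactin (product_topology (\<lambda>_. euclidean) UNIV) (PiE (UNIV :: 'i set) (\<lambda>_. {-R..R}))"
    by (subst compactin_PiE) simp
  ultimately show ?thesis by (simp add: euclidean_product_topology)
qed

text \<open>The extreme value theorem carried over to pairs of matrices: the topological hypotheses
  concern coordinates, the conclusion concerns matrices. The bound \<open>R\<close> confines the
  coordinates to a compact box.\<close>

lemma mat_pair_attains_min:
  fixes f :: "real mat \<times> real mat \<Rightarrow> real"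
  assumes cl: "closed {x. P (mat_pair a b x)}"
    and cont: "continuous_on {x. P (mat_pair a b x)} (\<lambda>x. f (mat_pair a b x))"
    and ne: "p0 \<in> carrier_mat a a \<times> carrier_mat b b" "P p0"
    and bdd: "\<And>p i j. p \<in> carrier_mat a a \<times> carrier_mat b b \<Longrightarrow> P p \<Longrightarrow>
      (i < a \<longrightarrow> j < a \<longrightarrow> \<bar>fst p $$ (i,j)\<bar> \<le> R) \<and> (i < b \<longrightarrow> j < b \<longrightarrow> \<bar>snd p $$ (i,j)\<bar> \<le> R)"
    and R: "R \<ge> 0"
  shows "\<exists>p \<in> carrier_mat a a \<times> carrier_mat b b. P p \<and>
    (\<forall>q \<in> carrier_mat a a \<times> carrier_mat b b. P q \<longrightarrow> f p \<le> f q)"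
proof -
  let ?B = "{g :: nat \<times> nat \<Rightarrow> real. \<forall>i. \<bar>g i\<bar> \<le> R}"
  define K where "K = (?B \<times> ?B) \<inter> {x. P (mat_pair a b x)}"
  have lift: "\<exists>x\<in>K. mat_pair a b x = p"
    if p: "p \<in> carrier_mat a a \<times> carrier_mat b b" "P p" for p
  proof -
    \<comment> \<open>Coordinates outside the index ranges do not affect \<open>mat_pair\<close>;
      the value 0 keeps them in the box because \<open>R\<close> is nonnegative.\<close>
    let ?x = "(\<lambda>(i,j). if i < a \<and> j < a then fst p $$ (i,j) else 0,
      \<lambda>(i,j). if i < b \<and> j < b then snd p $$ (i,j) else 0)"
    have "mat_pair a b ?x = p"
      using p(1) by (auto simp: mat_pair_def prod_eq_iff intro!: eq_matI)
    moreover have "?x \<in> ?B \<times> ?B" using bdd[OF p] R by auto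
    ultimately show ?thesis using p(2) unfolding K_def by (intro bexI[of _ ?x]) auto
  qed
  have "compact K" unfolding K_def by (intro compact_Int_closed compact_Times compact_box_fun cl)
  moreover have "K \<noteq> {}" using lift[OF ne] by blast
  moreover have "continuous_on K (\<lambda>x. f (mat_pair a b x))"
    by (rule continuous_on_subset[OF cont]) (auto simp: K_def)
  ultimately obtain x where x: "x \<in> K"
    "\<And>y. y \<in> K \<Longrightarrow> f (mat_pair a b x) \<le> f (mat_pair a b y)"
    using continuous_attains_inf[of K "\<lambda>x. f (mat_pair a b x)"] by blast
  have "mat_pair a b x \<in> carrier_mat a a \<times> carrier_mat b b" by (simp add: mat_pair_def)
  moreover have "f (mat_pair a b x) \<le> f q"
    if q: "q \<in> carrier_mat a a \<times> carrier_mat b b" "P q" for q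
  proof -
    obtain y where "y \<in> K" "mat_pair a b y = q" using lift[OF q] by blast
    then show ?thesis using x(2)[of y] by simp
  qed
  moreover have "P (mat_pair a b x)" using x(1) by (simp add: K_def)
  ultimately show ?thesis by (intro bexI[of _ "mat_pair a b x"] conjI ballI impI)
qed

section \<open>The linear map and its kernel\<close>

text \<open>One operation covers the vector space structure: differences have coefficients 1 and -1,
  multiples have second coefficient 0, and midpoints have both equal to 1/2.\<close>

definition pair_comb :: "real \<Rightarrow> real mat \<times> real mat \<Rightarrow> real \<Rightarrow> real mat \<times> real mat \<Rightarrow> real mat \<times> real mat"
  where "pair_comb s p t q = (s \<cdot>\<^sub>m fst p + t \<cdot>\<^sub>m fst q, s \<cdot>\<^sub>m snd p + t \<cdot>\<^sub>m snd q)"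

abbreviation sym_pairs :: "nat \<Rightarrow> nat \<Rightarrow> nat \<Rightarrow> (real mat \<times> real mat) set" where
  "sym_pairs m N n \<equiv> symS m (n+1) \<times> symS m N"

lemma Emat_carrier: "Emat m N n \<in> carrier_mat (m*N) (m*(n+1))"
  and Umat_carrier: "Umat m N \<in> carrier_mat (m*N) (m*N)"
  by (auto simp: Emat_def Umat_def)

lemma sym_pairsD:
  assumes "p \<in> sym_pairs m N n"
  shows "fst p \<in> carrier_mat (m*(n+1)) (m*(n+1))" "snd p \<in> carrier_mat (m*N) (m*N)"
    "(fst p)\<^sup>T = fst p" "(snd p)\<^sup>T = snd p"
  using assms by (auto simp: symS_def)

lemma pair_comb_sym:
  assumes p: "p \<in> sym_pairs m N n" and q: "q \<in> sym_pairs m N n"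
  shows "pair_comb s p t q \<in> sym_pairs m N n"
proof -
  have "s \<cdot>\<^sub>m A + t \<cdot>\<^sub>m B \<in> symS m k" if "A \<in> symS m k" "B \<in> symS m k" for A B k
  proof -
    have A: "A \<in> carrier_mat (m*k) (m*k)" "A\<^sup>T = A" and B: "B \<in> carrier_mat (m*k) (m*k)" "B\<^sup>T = B"
      using that by (auto simp: symS_def)
    have "(s \<cdot>\<^sub>m A + t \<cdot>\<^sub>m B)\<^sup>T = s \<cdot>\<^sub>m A + t \<cdot>\<^sub>m B"
      using A(1) B(1) symmetric_index[OF A] symmetric_index[OF B] by (intro eq_matI) auto
    then show ?thesis using A(1) B(1) by (simp add: symS_def)
  qed
  then show ?thesis using p q by (auto simp: pair_comb_def)
qed

lemma congruence_carrier_sym: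
  fixes X B :: "real mat"
  assumes "B \<in> carrier_mat a b" "X \<in> carrier_mat b b" "X\<^sup>T = X"
  shows "B * X * B\<^sup>T \<in> carrier_mat a a" "(B * X * B\<^sup>T)\<^sup>T = B * X * B\<^sup>T"
proof -
  have "(B * X * B\<^sup>T)\<^sup>T = (B\<^sup>T)\<^sup>T * (B * X)\<^sup>T"
    using assms by (intro transpose_mult[of _ a b _ a]) auto
  also have "\<dots> = B * (X * B\<^sup>T)" using assms by (simp add: transpose_mult[of B a b X b])
  also have "\<dots> = B * X * B\<^sup>T"
    using assms by (intro assoc_mult_mat[symmetric]) auto
  finally show "(B * X * B\<^sup>T)\<^sup>T = B * X * B\<^sup>T" .
qed (use assms in auto)

lemma Aop_carrier:
  assumes "p \<in> sym_pairs m N n"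
  shows "Aop m N n p \<in> carrier_mat (m*N) (m*N)" "(Aop m N n p)\<^sup>T = Aop m N n p"
proof -
  note p = sym_pairsD[OF assms]
  note E = congruence_carrier_sym[OF Emat_carrier p(1,3)]
  note U = congruence_carrier_sym[OF Umat_carrier p(2,4)]
  show "Aop m N n p \<in> carrier_mat (m*N) (m*N)"
    using p(2) by (simp add: Aop_def minus_carrier_mat)
  show "(Aop m N n p)\<^sup>T = Aop m N n p"
    unfolding Aop_def using E U p(2,4)
    by (simp add: transpose_minus[of _ "m*N" "m*N"] transpose_add[of _ "m*N" "m*N"])
qed

lemma congruence_comb:
  fixes X Y B :: "real mat"
  assumes "B \<in> carrier_mat a b" "X \<in> carrier_mat b b" "Y \<in> carrier_mat b b"
  shows "B * (s \<cdot>\<^sub>m X + t \<cdot>\<^sub>m Y) * B\<^sup>T = s \<cdot>\<^sub>m (B * X * B\<^sup>T) + t \<cdot>\<^sub>m (B * Y * B\<^sup>T)"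
  using assms
  by (simp add: mult_smult_distrib[of _ a b _ b] mult_smult_assoc_mat[of _ a b _ a]
      mult_add_distrib_mat[of _ a b _ b] add_mult_distrib_mat[of _ a b _ _ a])

lemma Aop_comb:
  assumes "p \<in> sym_pairs m N n" "q \<in> sym_pairs m N n"
  shows "Aop m N n (pair_comb s p t q) = s \<cdot>\<^sub>m Aop m N n p + t \<cdot>\<^sub>m Aop m N n q"
proof -
  note p = sym_pairsD[OF assms(1)] and q = sym_pairsD[OF assms(2)]
  note E = congruence_carrier_sym(1)[OF Emat_carrier p(1,3)] congruence_carrier_sym(1)[OF Emat_carrier q(1,3)]
  note U = congruence_carrier_sym(1)[OF Umat_carrier p(2,4)] congruence_carrier_sym(1)[OF Umat_carrier q(2,4)]
  have arith: "s \<cdot>\<^sub>m P + t \<cdot>\<^sub>m P' + (s \<cdot>\<^sub>m Q + t \<cdot>\<^sub>m Q') - (s \<cdot>\<^sub>m R + t \<cdot>\<^sub>m R')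
    = s \<cdot>\<^sub>m (P + Q - R) + t \<cdot>\<^sub>m (P' + Q' - R')"
    if "P \<in> carrier_mat d d" "P' \<in> carrier_mat d d" "Q \<in> carrier_mat d d" "Q' \<in> carrier_mat d d"
      "R \<in> carrier_mat d d" "R' \<in> carrier_mat d d" for P P' Q Q' R R' :: "real mat" and d
    using that by (intro eq_matI) (auto simp: algebra_simps)
  show ?thesis
    unfolding Aop_def pair_comb_def fst_conv snd_conv
      congruence_comb[OF Emat_carrier p(1) q(1)] congruence_comb[OF Umat_carrier p(2) q(2)]
    by (rule arith[OF E U p(2) q(2)])
qed

section \<open>The inner product and the orthogonal complement of the kernel\<close>

lemma pair_inner_comb:
  assumes "p \<in> sym_pairs m N n" "q \<in> sym_pairs m N n" "r \<in> sym_pairs m N n"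
  shows "pair_inner (pair_comb s p t q) r = s * pair_inner p r + t * pair_inner q r"
proof -
  have *: "mtrace ((s \<cdot>\<^sub>m A + t \<cdot>\<^sub>m B) * C) = s * mtrace (A * C) + t * mtrace (B * C)"
    if "A \<in> carrier_mat d d" "B \<in> carrier_mat d d" "C \<in> carrier_mat d d" for A B C d
    using that by (simp add: mtrace_mult[of _ d d] sum.distrib sum_distrib_left algebra_simps)
  show ?thesis
    using sym_pairsD[OF assms(1)] sym_pairsD[OF assms(2)] sym_pairsD[OF assms(3)]
    by (simp add: pair_inner_def pair_comb_def *[of _ "m*(n+1)"] *[of _ "m*N"] algebra_simps)
qed

lemma pair_inner_commute:
  assumes "p \<in> sym_pairs m N n" "q \<in> sym_pairs m N n"
  shows "pair_inner p q = pair_inner q p"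
  using sym_pairsD[OF assms(1)] sym_pairsD[OF assms(2)] unfolding pair_inner_def
  by (metis mtrace_mult_commute)

lemma pair_inner_comb_self:
  assumes p: "p \<in> sym_pairs m N n" and q: "q \<in> sym_pairs m N n"
  shows "pair_inner (pair_comb s p t q) (pair_comb s p t q)
    = s\<^sup>2 * pair_inner p p + 2 * s * t * pair_inner p q + t\<^sup>2 * pair_inner q q"
proof -
  let ?r = "pair_comb s p t q"
  note r = pair_comb_sym[OF p q, of s t]
  have "pair_inner ?r ?r = s * pair_inner ?r p + t * pair_inner ?r q"
    by (simp add: pair_inner_comb[OF p q r] pair_inner_commute[OF p r] pair_inner_commute[OF q r])
  also have "\<dots> = s\<^sup>2 * pair_inner p p + 2 * s * t * pair_inner p q + t\<^sup>2 * pair_inner q q"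
    by (simp add: pair_inner_comb[OF p q p] pair_inner_comb[OF p q q] pair_inner_commute[OF q p] power2_eq_square algebra_simps)
  finally show ?thesis .
qed

text \<open>For a symmetric matrix, Tr(A A) is the squared Frobenius norm; this gives definiteness
  of the inner product and bounds on single entries.\<close>

lemma pair_inner_self:
  assumes "p \<in> sym_pairs m N n"
  shows "pair_inner p p = (\<Sum>i<m*(n+1). \<Sum>j<m*(n+1). (fst p $$ (i,j))\<^sup>2)
    + (\<Sum>i<m*N. \<Sum>j<m*N. (snd p $$ (i,j))\<^sup>2)"
proof -
  have *: "mtrace (A * A) = (\<Sum>i<d. \<Sum>j<d. (A $$ (i,j))\<^sup>2)"
    if "A \<in> carrier_mat d d" "A\<^sup>T = A" for A d
    unfolding mtrace_mult[OF that(1,1)]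
    by (intro sum.cong refl) (simp add: symmetric_index[OF that] power2_eq_square)
  note p = sym_pairsD[OF assms]
  show ?thesis unfolding pair_inner_def *[OF p(1,3)] *[OF p(2,4)] ..
qed

lemma entry_le_sum_squares:
  fixes f :: "nat \<Rightarrow> nat \<Rightarrow> real"
  assumes "i < d" "j < d"
  shows "(f i j)\<^sup>2 \<le> (\<Sum>i<d. \<Sum>j<d. (f i j)\<^sup>2)"
proof -
  have "(f i j)\<^sup>2 \<le> (\<Sum>j<d. (f i j)\<^sup>2)" using assms by (intro member_le_sum) auto
  also have "\<dots> \<le> (\<Sum>i<d. \<Sum>j<d. (f i j)\<^sup>2)"
    using assms by (intro member_le_sum[of i "{..<d}" "\<lambda>i. \<Sum>j<d. (f i j)\<^sup>2"]) (auto intro: sum_nonneg)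
  finally show ?thesis .
qed

lemma pair_inner_self_entries:
  assumes "p \<in> sym_pairs m N n"
  shows "pair_inner p p \<ge> 0"
    "i < m*(n+1) \<Longrightarrow> j < m*(n+1) \<Longrightarrow> (fst p $$ (i,j))\<^sup>2 \<le> pair_inner p p"
    "i < m*N \<Longrightarrow> j < m*N \<Longrightarrow> (snd p $$ (i,j))\<^sup>2 \<le> pair_inner p p"
proof -
  have nn: "(\<Sum>i<d. \<Sum>j<d. (f i j :: real)\<^sup>2) \<ge> 0" for f and d :: nat
    by (intro sum_nonneg) auto
  note self = pair_inner_self[OF assms]
  show "pair_inner p p \<ge> 0" unfolding self by (intro add_nonneg_nonneg nn)
  show "(fst p $$ (i,j))\<^sup>2 \<le> pair_inner p p" if "i < m*(n+1)" "j < m*(n+1)"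
    unfolding self
    using entry_le_sum_squares[OF that, of "\<lambda>i j. fst p $$ (i,j)"] nn[of "\<lambda>i j. snd p $$ (i,j)" "m*N"]
    by linarith
  show "(snd p $$ (i,j))\<^sup>2 \<le> pair_inner p p" if "i < m*N" "j < m*N"
    unfolding self
    using entry_le_sum_squares[OF that, of "\<lambda>i j. snd p $$ (i,j)"] nn[of "\<lambda>i j. fst p $$ (i,j)" "m*(n+1)"]
    by linarith
qed

lemma pair_entries_bounded:
  assumes p: "p \<in> sym_pairs m N n" and "pair_inner p p \<le> c"
  shows "(i < m*(n+1) \<longrightarrow> j < m*(n+1) \<longrightarrow> \<bar>fst p $$ (i,j)\<bar> \<le> sqrt c) \<and>
    (i < m*N \<longrightarrow> j < m*N \<longrightarrow> \<bar>snd p $$ (i,j)\<bar> \<le> sqrt c)"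
  using pair_inner_self_entries(2,3)[OF p, of i j] assms(2)
  by (auto intro!: real_le_rsqrt)

lemma pair_inner_self_zero:
  assumes p: "p \<in> sym_pairs m N n" and "pair_inner p p = 0"
  shows "p = (0\<^sub>m (m*(n+1)) (m*(n+1)), 0\<^sub>m (m*N) (m*N))"
  using pair_inner_self_entries(2,3)[OF p] sym_pairsD(1,2)[OF p] assms(2)
  by (auto simp: prod_eq_iff intro!: eq_matI)

lemma kerA_perp_sym: "p \<in> kerA_perp m N n \<Longrightarrow> p \<in> sym_pairs m N n"
  by (simp add: kerA_perp_def)

lemma pair_comb_perp:
  assumes "p \<in> kerA_perp m N n" "q \<in> kerA_perp m N n"
  shows "pair_comb s p t q \<in> kerA_perp m N n"
  unfolding kerA_perp_def
proof (intro CollectI conjI ballI)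
  show "pair_comb s p t q \<in> sym_pairs m N n" using assms by (intro pair_comb_sym kerA_perp_sym)
  fix r assume r: "r \<in> kerA m N n"
  then have "r \<in> sym_pairs m N n" by (simp add: kerA_def)
  with r show "pair_inner (pair_comb s p t q) r = 0"
    using pair_inner_comb[OF kerA_perp_sym[OF assms(1)] kerA_perp_sym[OF assms(2)]] assms
    by (simp add: kerA_perp_def)
qed

text \<open>The difference of the two pairs lies both in the kernel and in its orthogonal
  complement, hence is orthogonal to itself.\<close>

lemma Aop_inj_on_perp:
  assumes p: "p \<in> kerA_perp m N n" and q: "q \<in> kerA_perp m N n"
    and eq: "Aop m N n p = Aop m N n q"
  shows "p = q"
proof -
  note ps = kerA_perp_sym[OF p] and qs = kerA_perp_sym[OF q]
  let ?r = "pair_comb 1 p (-1) q"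
  have rs: "?r \<in> sym_pairs m N n" by (rule pair_comb_sym[OF ps qs])
  have "Aop m N n ?r = 0\<^sub>m (m*N) (m*N)"
    unfolding Aop_comb[OF ps qs] eq using Aop_carrier(1)[OF qs] by (intro eq_matI) auto
  with rs have "?r \<in> kerA m N n" by (simp add: kerA_def)
  then have "pair_inner ?r ?r = 0" using pair_comb_perp[OF p q] unfolding kerA_perp_def by blast
  from pair_inner_self_zero[OF rs this]
  have *: "1 \<cdot>\<^sub>m fst p + (-1) \<cdot>\<^sub>m fst q = 0\<^sub>m (m*(n+1)) (m*(n+1))"
    "1 \<cdot>\<^sub>m snd p + (-1) \<cdot>\<^sub>m snd q = 0\<^sub>m (m*N) (m*N)" by (auto simp: pair_comb_def)
  have eqI: "A = B" if "1 \<cdot>\<^sub>m A + (-1) \<cdot>\<^sub>m B = 0\<^sub>m d d" "A \<in> carrier_mat d d" "B \<in> carrier_mat d d"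
    for A B :: "real mat" and d
  proof (rule eq_matI)
    fix i j assume "i < dim_row B" "j < dim_col B"
    then have "(1 \<cdot>\<^sub>m A + (-1) \<cdot>\<^sub>m B) $$ (i,j) = A $$ (i,j) - B $$ (i,j)" "i < d" "j < d"
      using that(2,3) by auto
    then show "A $$ (i,j) = B $$ (i,j)" using that(1) by simp
  qed (use that in auto)
  show "p = q" using eqI[OF *(1)] eqI[OF *(2)] sym_pairsD(1,2)[OF ps] sym_pairsD(1,2)[OF qs]
    by (simp add: prod_eq_iff)
qed

text \<open>Feasibility of \<open>S\<close> makes the linear term of \<^const>\<open>Jfun\<close> a function of \<^const>\<open>Aop\<close> alone:
  the \<open>\<Theta>\<close>-part of \<^const>\<open>Aop\<close> is orthogonal to every block-circulant matrix.\<close>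

lemma mtrace_Tmat:
  assumes p: "p \<in> sym_pairs m N n" and S: "S \<in> carrier_mat (m*N) (m*N)"
    and ET: "(Emat m N n)\<^sup>T * S * Emat m N n = Tmat m n \<Sigma>"
    and US: "(Umat m N)\<^sup>T * S * Umat m N = S"
  shows "mtrace (fst p * Tmat m n \<Sigma>) = mtrace (Aop m N n p * S)"
proof -
  note pc = sym_pairsD[OF p]
  \<comment> \<open>Cyclicity of the trace moves the congruence from X to S; it serves for both
    \<open>Emat\<close> and \<open>Umat\<close>.\<close>
  have cyc: "mtrace (B * X * B\<^sup>T * S) = mtrace (X * (B\<^sup>T * S * B))"
    if B: "B \<in> carrier_mat (m*N) b" and X: "X \<in> carrier_mat b b" for B X b
  proof -
    have "B * X * B\<^sup>T * S = B * (X * (B\<^sup>T * S))"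
      using B X S by (simp add: assoc_mult_mat[of _ "m*N" b _ b _ "m*N"]
        assoc_mult_mat[of _ "m*N" b _ "m*N" _ "m*N"] assoc_mult_mat[of _ b b _ "m*N" _ "m*N"])
    moreover have "X * (B\<^sup>T * S * B) = X * (B\<^sup>T * S) * B"
      using B X S by (intro assoc_mult_mat[symmetric]) auto
    moreover have "mtrace (B * (X * (B\<^sup>T * S))) = mtrace (X * (B\<^sup>T * S) * B)"
      using B X S by (intro mtrace_mult_commute[of _ "m*N" b]) auto
    ultimately show ?thesis by simp
  qed
  let ?P = "Emat m N n * fst p * (Emat m N n)\<^sup>T" and ?Q = "Umat m N * snd p * (Umat m N)\<^sup>T"
  have P: "?P \<in> carrier_mat (m*N) (m*N)" and Q: "?Q \<in> carrier_mat (m*N) (m*N)"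
    using congruence_carrier_sym[OF Emat_carrier pc(1,3)] congruence_carrier_sym[OF Umat_carrier pc(2,4)]
    by auto
  have "mtrace (Aop m N n p * S) = mtrace (?P * S) + mtrace (?Q * S) - mtrace (snd p * S)"
  proof -
    have "Aop m N n p * S = ?P * S + ?Q * S - snd p * S"
      unfolding Aop_def using P Q pc(2) S
      by (simp add: minus_mult_distrib_mat[of _ "m*N" "m*N"] add_mult_distrib_mat[of _ "m*N" "m*N"]
          del: assoc_mult_mat)
    then show ?thesis using P Q pc(2) S
      by (simp add: mtrace_linear[of _ "m*N"] del: assoc_mult_mat)
  qed
  \<comment> \<open>The \<open>Emat\<close> term becomes the trace against \<open>Tmat\<close>; the
    \<open>Umat\<close> term becomes Tr(\<Theta> S) by shift invariance of \<open>S\<close> and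
    cancels the subtracted term.\<close>
  then show ?thesis
    by (simp only: cyc[OF Emat_carrier pc(1)] cyc[OF Umat_carrier pc(2)] ET US)
qed

section \<open>Existence and uniqueness of the minimum\<close>

lemma congruence_index:
  fixes B X :: "real mat"
  assumes "B \<in> carrier_mat a b" "X \<in> carrier_mat b b" "i < a" "j < a"
  shows "(B * X * B\<^sup>T) $$ (i,j) = (\<Sum>l<b. (\<Sum>k<b. B $$ (i,k) * X $$ (k,l)) * B $$ (j,l))"
proof -
  have "(B * X * B\<^sup>T) $$ (i,j) = (\<Sum>l<b. (B * X) $$ (i,l) * B\<^sup>T $$ (l,j))"
    using assms by (intro index_mult_sum) auto
  also have "\<dots> = (\<Sum>l<b. (\<Sum>k<b. B $$ (i,k) * X $$ (k,l)) * B $$ (j,l))"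
    using assms by (intro sum.cong refl arg_cong2[of _ _ _ _ "(*)"] index_mult_sum) auto
  finally show ?thesis .
qed

text \<open>Rows i and j of \<open>B\<close> select the entries with indices \<open>f i\<close> and
  \<open>f j\<close>. An index \<open>f i \<ge> b\<close> stands for a zero row, as in the lower
  part of \<open>Emat\<close>; the rows of \<open>Umat\<close> follow the cyclic shift.\<close>

lemma congruence_index_indicator:
  fixes B X :: "real mat"
  assumes BX: "B \<in> carrier_mat a b" "X \<in> carrier_mat b b" "i < a" "j < a"
    and i: "\<And>k. k < b \<Longrightarrow> B $$ (i,k) = (if k = f i then 1 else 0)"
    and j: "\<And>k. k < b \<Longrightarrow> B $$ (j,k) = (if k = f j then 1 else 0)"
  shows "(B * X * B\<^sup>T) $$ (i,j) = (if f i < b \<and> f j < b then X $$ (f i, f j) else 0)"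
proof -
  have row: "(\<Sum>k<b. B $$ (i,k) * X $$ (k,l)) = (if f i < b then X $$ (f i, l) else 0)" for l
  proof -
    have "(\<Sum>k<b. B $$ (i,k) * X $$ (k,l)) = (\<Sum>k<b. if k = f i then X $$ (k,l) else 0)"
      by (intro sum.cong) (auto simp: i)
    then show ?thesis by (simp add: sum.delta)
  qed
  have "(B * X * B\<^sup>T) $$ (i,j) = (\<Sum>l<b. if l = f j then (if f i < b then X $$ (f i, l) else 0) else 0)"
    unfolding congruence_index[OF BX] row by (intro sum.cong) (auto simp: j)
  then show ?thesis by (simp add: sum.delta)
qed

text \<open>Put \<open>N\<close> times the identity into the first diagonal block; the block-diagonal \<open>\<Theta>\<close> with
  blocks \<open>0, 1 - N, \<dots>, -1\<close> then redistributes it evenly along the cycle.\<close>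

lemma Aop_eq_one_feasible:
  assumes m: "m \<ge> 1" and n: "n + 1 \<le> N" and N: "N \<ge> 2"
  shows "\<exists>p \<in> sym_pairs m N n. Aop m N n p = 1\<^sub>m (m*N)"
proof
  let ?L = "mat (m*(n+1)) (m*(n+1)) (\<lambda>(i,j). if i = j \<and> i < m then real N else 0)"
  let ?T = "mat (m*N) (m*N) (\<lambda>(i,j). if i = j \<and> i \<ge> m then real (i div m) - real N else 0)"
  \<comment> \<open>The same position in the cyclically next block: row i of \<open>Umat\<close> has
    its only 1 in column \<open>\<sigma> i\<close>.\<close>
  define \<sigma> where "\<sigma> i = ((i div m + 1) mod N) * m + i mod m" for i
  have \<sigma>_div: "\<sigma> i div m = (i div m + 1) mod N" and \<sigma>_mod: "\<sigma> i mod m = i mod m" for i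
    using m by (auto simp: \<sigma>_def)
  have divmod: "i = j" if "i div m = j div m" "i mod m = j mod m" for i j
    using that by (metis div_mult_mod_eq)
  have \<sigma>_iff: "k = \<sigma> i \<longleftrightarrow> k div m = (i div m + 1) mod N \<and> k mod m = i mod m" for k i
    using divmod \<sigma>_div \<sigma>_mod by metis
  have \<sigma>_less: "\<sigma> i < m * N" for i
  proof -
    have "\<sigma> i div m < N" using N by (simp add: \<sigma>_div)
    then show ?thesis by (metis less_mult_imp_div_less div_less_iff_less_mult m less_eq_Suc_le One_nat_def mult.commute)
  qed
  have div_less: "i div m < N" if "i < m * N" for i
    using that m by (simp add: less_mult_imp_div_less mult.commute)
  have \<sigma>_inj: "i = j" if "\<sigma> i = \<sigma> j" "i < m * N" "j < m * N" for i j
  proof (rule divmod)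
    show "i mod m = j mod m" using that(1) \<sigma>_mod by metis
    have "(i div m + 1) mod N = (j div m + 1) mod N" using that(1) \<sigma>_div by metis
    then show "i div m = j div m"
      using div_less[OF that(2)] div_less[OF that(3)]
      by (auto simp: mod_Suc split: if_splits)
  qed
  have diag_sym: "mat (m*k) (m*k) (\<lambda>(i,j). if i = j \<and> Q i then h i else 0) \<in> symS m k" for k Q and h :: "nat \<Rightarrow> real"
    unfolding symS_def by (simp, rule eq_matI) auto
  show p: "(?L, ?T) \<in> sym_pairs m N n" by (rule SigmaI; rule diag_sym)
  show "Aop m N n (?L, ?T) = 1\<^sub>m (m*N)"
  proof (intro eq_matI)
    fix i j assume "i < dim_row (1\<^sub>m (m*N) :: real mat)" "j < dim_col (1\<^sub>m (m*N) :: real mat)"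
    then have ij: "i < m*N" "j < m*N" by auto
    have E: "(Emat m N n * ?L * (Emat m N n)\<^sup>T) $$ (i,j)
        = (if i < m*(n+1) \<and> j < m*(n+1) then ?L $$ (i,j) else 0)"
    proof (rule congruence_index_indicator[where f = "\<lambda>i. i" and b = "m*(n+1)"])
      show "Emat m N n $$ (i,k) = (if k = i then 1 else 0)" if "k < m*(n+1)" for k
        using ij that divmod[of i k] by (auto simp: Emat_def)
      show "Emat m N n $$ (j,k) = (if k = j then 1 else 0)" if "k < m*(n+1)" for k
        using ij that divmod[of j k] by (auto simp: Emat_def)
    qed (use ij Emat_carrier in auto)
    have U: "(Umat m N * ?T * (Umat m N)\<^sup>T) $$ (i,j)
        = (if \<sigma> i < m*N \<and> \<sigma> j < m*N then ?T $$ (\<sigma> i, \<sigma> j) else 0)"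
    proof (rule congruence_index_indicator[where f = \<sigma> and b = "m*N"])
      show "Umat m N $$ (i,k) = (if k = \<sigma> i then 1 else 0)" if "k < m*N" for k
        unfolding \<sigma>_iff using ij that by (auto simp: Umat_def)
      show "Umat m N $$ (j,k) = (if k = \<sigma> j then 1 else 0)" if "k < m*N" for k
        unfolding \<sigma>_iff using ij that by (auto simp: Umat_def)
    qed (use ij Umat_carrier in auto)
    have "m \<le> m * (n+1)" by simp
    then have E': "(Emat m N n * ?L * (Emat m N n)\<^sup>T) $$ (i,j) = (if i = j \<and> i < m then real N else 0)"
      unfolding E by auto
    have U': "(Umat m N * ?T * (Umat m N)\<^sup>T) $$ (i,j)
        = (if i = j \<and> \<sigma> i \<ge> m then real (\<sigma> i div m) - real N else 0)"
    proof (cases "i = j")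
      case True
      then show ?thesis unfolding U using \<sigma>_less[of j] by simp
    next
      case False
      then have "\<sigma> i \<noteq> \<sigma> j" using \<sigma>_inj ij by blast
      then show ?thesis unfolding U using False \<sigma>_less[of i] \<sigma>_less[of j] by simp
    qed
    have "Aop m N n (?L, ?T) $$ (i,j) = (Emat m N n * ?L * (Emat m N n)\<^sup>T) $$ (i,j)
        + (Umat m N * ?T * (Umat m N)\<^sup>T) $$ (i,j) - ?T $$ (i,j)"
      using ij Emat_carrier[of m N n] Umat_carrier[of m N] by (simp add: Aop_def del: index_mult_mat(1))
    also have "\<dots> = (if i = j then 1 else 0)"
    proof (cases "i = j")
      case True
      have ge: "k \<ge> m \<longleftrightarrow> k div m \<noteq> 0" for k using m by (simp add: div_eq_0_iff not_less)
      have lt: "k < m \<longleftrightarrow> k div m = 0" for k using m by (simp add: div_eq_0_iff)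
      \<comment> \<open>On diagonal block k the value is N + (1 - N) - 0 for k = 0, then (k + 1 - N)
        - (k - N) in between, and 0 - (-1) for k = N - 1. Since \<open>N \<ge> 2\<close>, the first
        and last blocks are distinct.\<close>
      show ?thesis
        unfolding E' U' using True ij div_less[OF ij(1)] N
        by (auto simp: ge lt \<sigma>_div mod_Suc split: if_splits)
    next
      case False
      then show ?thesis unfolding E' U' using ij by simp
    qed
    finally show "Aop m N n (?L, ?T) $$ (i,j) = 1\<^sub>m (m*N) $$ (i,j)" using ij by simp
  qed (use Aop_carrier(1)[OF p] in auto)
qed

section \<open>Continuity of the linear map, closed constraint sets and coercivity\<close>

lemma cont_mat_Aop:
  "cont_mat (m*N) (m*N) (\<lambda>x. Aop m N n (mat_pair (m*(n+1)) (m*N) x))"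
  unfolding Aop_def
  by (rule cont_mat_diff cont_mat_add cont_mat_mult[OF cont_mat_mult] cont_mat_const cont_mat_pair
      transpose_carrier_mat[THEN iffD2] Emat_carrier Umat_carrier)+

lemma continuous_on_mtrace_Aop:
  assumes "S \<in> carrier_mat (m*N) (m*N)"
  shows "continuous_on X (\<lambda>x. mtrace (Aop m N n (mat_pair (m*(n+1)) (m*N) x) * S))"
  by (rule continuous_on_subset[OF continuous_on_mtrace[OF cont_mat_mult[OF cont_mat_Aop
      cont_mat_const[OF assms]]] subset_UNIV])

lemma continuous_on_pair_inner:
  "continuous_on UNIV (\<lambda>x. pair_inner (mat_pair (m*(n+1)) (m*N) x) (mat_pair (m*(n+1)) (m*N) x))"
  unfolding pair_inner_def
  by (rule continuous_on_add continuous_on_mtrace cont_mat_mult cont_mat_pair)+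

lemma closed_sym_pairs: "closed {x. mat_pair (m*(n+1)) (m*N) x \<in> sym_pairs m N n}"
proof -
  have "{x. mat_pair (m*(n+1)) (m*N) x \<in> sym_pairs m N n}
    = {x. (fst (mat_pair (m*(n+1)) (m*N) x))\<^sup>T = fst (mat_pair (m*(n+1)) (m*N) x)}
    \<inter> {x. (snd (mat_pair (m*(n+1)) (m*N) x))\<^sup>T = snd (mat_pair (m*(n+1)) (m*N) x)}"
    by (auto simp: symS_def mat_pair_def)
  also have "closed \<dots>" by (rule closed_Int closed_mat_eq cont_mat_transpose cont_mat_pair)+
  finally show ?thesis .
qed

lemma closed_kerA_perp: "closed {x. mat_pair (m*(n+1)) (m*N) x \<in> kerA_perp m N n}"
proof -
  have "{x. mat_pair (m*(n+1)) (m*N) x \<in> kerA_perp m N n}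
    = {x. mat_pair (m*(n+1)) (m*N) x \<in> sym_pairs m N n}
    \<inter> (\<Inter>q\<in>kerA m N n. {x. pair_inner (mat_pair (m*(n+1)) (m*N) x) q = 0})"
    by (auto simp: kerA_perp_def)
  also have "closed \<dots>"
  proof (intro closed_Int closed_sym_pairs closed_INT ballI closed_Collect_eq continuous_on_const)
    fix q assume "q \<in> kerA m N n"
    then have "q \<in> sym_pairs m N n" by (simp add: kerA_def)
    note qc = sym_pairsD(1,2)[OF this]
    show "continuous_on UNIV (\<lambda>x. pair_inner (mat_pair (m*(n+1)) (m*N) x) q)"
      unfolding pair_inner_def
      by (rule continuous_on_add continuous_on_mtrace
          cont_mat_mult[OF cont_mat_pair(1) cont_mat_const[OF qc(1)]]
          cont_mat_mult[OF cont_mat_pair(2) cont_mat_const[OF qc(2)]])+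
  qed
  finally show ?thesis .
qed

text \<open>A preimage of least norm is orthogonal to the kernel.\<close>

lemma kerA_perp_preimage:
  assumes p0: "p0 \<in> sym_pairs m N n"
  shows "\<exists>p \<in> kerA_perp m N n. Aop m N n p = Aop m N n p0"
proof -
  let ?a = "m*(n+1)" and ?b = "m*N"
  \<comment> \<open>The norm bound by that of \<open>p0\<close> makes the set of competitors compact
    without changing the least norm.\<close>
  let ?P = "\<lambda>p. p \<in> sym_pairs m N n \<and> Aop m N n p = Aop m N n p0 \<and> pair_inner p p \<le> pair_inner p0 p0"
  have "\<exists>p \<in> carrier_mat ?a ?a \<times> carrier_mat ?b ?b. ?P p \<and>
    (\<forall>q \<in> carrier_mat ?a ?a \<times> carrier_mat ?b ?b. ?P q \<longrightarrow> pair_inner p p \<le> pair_inner q q)"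
  proof (rule mat_pair_attains_min[where R = "sqrt (pair_inner p0 p0)"])
    show "closed {x. ?P (mat_pair ?a ?b x)}"
      by (rule closed_Collect_conj closed_sym_pairs closed_mat_eq[OF cont_mat_Aop cont_mat_const]
          Aop_carrier(1)[OF p0] closed_Collect_le continuous_on_pair_inner continuous_on_const)+
    show "continuous_on {x. ?P (mat_pair ?a ?b x)} (\<lambda>x. pair_inner (mat_pair ?a ?b x) (mat_pair ?a ?b x))"
      by (rule continuous_on_subset[OF continuous_on_pair_inner]) simp
    show "p0 \<in> carrier_mat ?a ?a \<times> carrier_mat ?b ?b" using p0 by (auto simp: symS_def)
    show "0 \<le> sqrt (pair_inner p0 p0)" using pair_inner_self_entries(1)[OF p0] by simp
  qed (use p0 pair_entries_bounded in blast)+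
  then obtain p where p: "?P p"
    "\<And>q. q \<in> carrier_mat ?a ?a \<times> carrier_mat ?b ?b \<Longrightarrow> ?P q \<Longrightarrow> pair_inner p p \<le> pair_inner q q"
    by blast
  have ps: "p \<in> sym_pairs m N n" using p(1) by simp
  \<comment> \<open>A preimage violating the norm bound has larger norm than \<open>p0\<close>,
    hence than p.\<close>
  have min: "pair_inner p p \<le> pair_inner q q"
    if "q \<in> sym_pairs m N n" "Aop m N n q = Aop m N n p0" for q
    using p(1) p(2)[of q] that sym_pairsD(1,2)[OF that(1)]
    by (cases "pair_inner q q \<le> pair_inner p0 p0") (auto simp: mem_Times_iff)
  \<comment> \<open>Adding t * r does not change the image, so p minimises the norm along this line
    and the linear term in t vanishes.\<close>
  have "pair_inner p r = 0" if r: "r \<in> kerA m N n" for r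
  proof (rule linear_term_zero)
    fix t
    have rs: "r \<in> sym_pairs m N n" and Ar: "Aop m N n r = 0\<^sub>m ?b ?b" using r by (auto simp: kerA_def)
    have "Aop m N n (pair_comb 1 p t r) = Aop m N n p0"
      unfolding Aop_comb[OF ps rs] Ar using p(1) Aop_carrier(1)[OF p0] by (intro eq_matI) auto
    from min[OF pair_comb_sym[OF ps rs] this]
    show "0 \<le> 2 * t * pair_inner p r + t\<^sup>2 * pair_inner r r"
      unfolding pair_inner_comb_self[OF ps rs] by simp
  qed
  then have "p \<in> kerA_perp m N n" using ps by (simp add: kerA_perp_def)
  then show ?thesis using p(1) by blast
qed

text \<open>On unit vectors p of the complement with A(p) positive semidefinite, the trace attains a
  minimum. It is positive: a zero trace would give A(p) = 0, putting p in the kernel as well as in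
  its complement. Homogeneity extends the bound to all norms.\<close>

lemma mtrace_Aop_coercive:
  assumes S: "pos_def_mat (m*N) S"
  shows "\<exists>\<mu>>0. \<forall>p \<in> kerA_perp m N n. psd_mat (m*N) (Aop m N n p) \<longrightarrow>
    \<mu> * sqrt (pair_inner p p) \<le> mtrace (Aop m N n p * S)"
proof -
  let ?a = "m*(n+1)" and ?b = "m*N"
  have Sc: "S \<in> carrier_mat ?b ?b" using S by (simp add: pos_def_mat_def)
  let ?P = "\<lambda>p. p \<in> kerA_perp m N n \<and> psd_mat ?b (Aop m N n p) \<and> pair_inner p p = 1"
  let ?f = "\<lambda>p. mtrace (Aop m N n p * S)"
  have "\<exists>\<mu>>0. \<forall>p. ?P p \<longrightarrow> \<mu> \<le> ?f p"
  proof (cases "\<exists>p. ?P p")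
    case True
    then obtain p0 where p0: "?P p0" by blast
    have car: "p \<in> carrier_mat ?a ?a \<times> carrier_mat ?b ?b" if "?P p" for p
      using sym_pairsD(1,2)[OF kerA_perp_sym[of p]] that by (auto simp: mem_Times_iff)
    have "\<exists>p \<in> carrier_mat ?a ?a \<times> carrier_mat ?b ?b. ?P p \<and>
      (\<forall>q \<in> carrier_mat ?a ?a \<times> carrier_mat ?b ?b. ?P q \<longrightarrow> ?f p \<le> ?f q)"
    proof (rule mat_pair_attains_min[where R = "sqrt 1"])
      show "closed {x. ?P (mat_pair ?a ?b x)}"
        by (rule closed_Collect_conj closed_kerA_perp closed_psd_mat cont_mat_Aop
            closed_Collect_eq continuous_on_pair_inner continuous_on_const)+
      show "continuous_on {x. ?P (mat_pair ?a ?b x)} (\<lambda>x. ?f (mat_pair ?a ?b x))"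
        by (rule continuous_on_mtrace_Aop[OF Sc])
      show "(i < ?a \<longrightarrow> j < ?a \<longrightarrow> \<bar>fst p $$ (i,j)\<bar> \<le> sqrt 1) \<and>
        (i < ?b \<longrightarrow> j < ?b \<longrightarrow> \<bar>snd p $$ (i,j)\<bar> \<le> sqrt 1)" if "?P p" for p i j
        using that by (intro pair_entries_bounded kerA_perp_sym) auto
    qed (use p0 car[OF p0] in auto)
    then obtain p where p: "?P p" "\<And>q. ?P q \<Longrightarrow> ?f p \<le> ?f q" using car by metis
    have ps: "p \<in> sym_pairs m N n" using p(1) by (intro kerA_perp_sym) simp
    have "?f p \<noteq> 0"
    proof
      assume "?f p = 0"
      then have "Aop m N n p = 0\<^sub>m ?b ?b" using trace_psd_mult(2)[OF _ S] p(1) by blast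
      then have "p \<in> kerA m N n" using ps by (simp add: kerA_def)
      then have "pair_inner p p = 0" using p(1) unfolding kerA_perp_def by blast
      with p(1) show False by simp
    qed
    then have "?f p > 0" using trace_psd_mult(1)[OF _ S, of "Aop m N n p"] p(1) by auto
    then show ?thesis using p(2) by blast
  \<comment> \<open>If no unit vector qualifies, any positive constant works.\<close>
  qed (auto intro: exI[of _ 1])
  then obtain \<mu> where \<mu>: "\<mu> > 0" "\<And>p. ?P p \<Longrightarrow> \<mu> \<le> ?f p" by blast
  have "\<mu> * sqrt (pair_inner p p) \<le> ?f p"
    if p: "p \<in> kerA_perp m N n" and psd: "psd_mat ?b (Aop m N n p)" for p
  proof (cases "pair_inner p p = 0")
    case True
    then show ?thesis using trace_psd_mult(1)[OF psd S] by simp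
  next
    case False
    have ps: "p \<in> sym_pairs m N n" using p by (rule kerA_perp_sym)
    define r where "r = sqrt (pair_inner p p)"
    have r: "r > 0" "r\<^sup>2 = pair_inner p p"
      using False pair_inner_self_entries(1)[OF ps] by (auto simp: r_def)
    \<comment> \<open>The normalised pair p / r.\<close>
    let ?q = "pair_comb (1 / r) p 0 p"
    have A: "Aop m N n p \<in> carrier_mat ?b ?b" by (rule Aop_carrier(1)[OF ps])
    have Aq: "Aop m N n ?q = (1 / r) \<cdot>\<^sub>m Aop m N n p"
      unfolding Aop_comb[OF ps ps] using A by (intro eq_matI) auto
    have "pair_inner ?q ?q = 1"
      unfolding pair_inner_comb_self[OF ps ps] using r False by (simp add: power_divide)
    moreover have "psd_mat ?b (Aop m N n ?q)"
    proof -
      have "v \<bullet> (((1 / r) \<cdot>\<^sub>m Aop m N n p) *\<^sub>v v) = (1 / r) * (v \<bullet> (Aop m N n p *\<^sub>v v))"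
        if "v \<in> carrier_vec ?b" for v
        using A that by (simp add: quadratic_form_sum[of _ ?b] sum_distrib_left algebra_simps)
      then show ?thesis
        using psd r(1) Aop_carrier[OF pair_comb_sym[OF ps ps, of "1 / r" 0]] unfolding Aq psd_mat_def by simp
    qed
    ultimately have "\<mu> \<le> ?f ?q" using \<mu>(2) pair_comb_perp[OF p p] by blast
    also have "?f ?q = ?f p / r"
      unfolding Aq using A Sc
      by (simp add: mult_smult_assoc_mat[of _ ?b ?b _ ?b] mtrace_linear(3)[of _ ?b])
    finally show ?thesis using r(1) unfolding r_def[symmetric] by (simp add: field_simps)
  qed
  then show ?thesis using \<mu>(1) by blast
qed

text \<open>The identity is positive definite and has a preimage orthogonal to the kernel.\<close>

lemma Lplus_nonempty:
  assumes "m \<ge> 1" "n + 1 \<le> N" "N \<ge> 2"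
  shows "\<exists>p. p \<in> Lplus m N n"
proof -
  obtain p where p: "p \<in> kerA_perp m N n" "Aop m N n p = 1\<^sub>m (m*N)"
    using Aop_eq_one_feasible[OF assms] kerA_perp_preimage by metis
  have "pos_def_mat d (1\<^sub>m d)" for d
  proof -
    have "v \<bullet> v > 0" if v: "v \<in> carrier_vec d" "v \<noteq> 0\<^sub>v d" for v :: "real vec"
    proof -
      obtain i where "i < d" "v $ i \<noteq> 0"
        using v by (metis carrier_vecD eq_vecI index_zero_vec(1) index_zero_vec(2))
      then have "(\<Sum>i<d. (v $ i)\<^sup>2) > 0"
        by (intro sum_pos2[of _ i]) auto
      then show ?thesis using v by (simp add: scalar_prod_def atLeast0LessThan power2_eq_square)
    qed
    then show ?thesis by (simp add: pos_def_mat_def)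
  qed
  with p have "p \<in> Lplus m N n" by (simp add: Lplus_def)
  then show ?thesis ..
qed

text \<open>The search is confined to a compact set containing the sublevel set of an arbitrary
  \<open>p1\<close> in \<open>Lplus\<close> and itself contained in \<open>Lplus\<close>; a minimum
  there is global.\<close>

lemma Lplus_minimum_exists:
  assumes S: "pos_def_mat (m*N) S" and ne: "\<exists>p. p \<in> Lplus m N n"
    and J: "\<And>p. p \<in> sym_pairs m N n \<Longrightarrow> Jfun m N n \<Sigma> p = mtrace (Aop m N n p * S) - ln (det (Aop m N n p))"
  shows "\<exists>p \<in> Lplus m N n. \<forall>q \<in> Lplus m N n. Jfun m N n \<Sigma> p \<le> Jfun m N n \<Sigma> q"
proof -
  let ?a = "m*(n+1)" and ?b = "m*N"
  let ?J = "Jfun m N n \<Sigma>"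
  have Sc: "S \<in> carrier_mat ?b ?b" using S by (simp add: pos_def_mat_def)
  obtain p1 where p1: "p1 \<in> Lplus m N n" using ne by blast
  obtain c where c: "\<And>M. pos_def_mat ?b M \<Longrightarrow> ln (det M) \<le> mtrace (M * S) / 2 + c"
    using ln_det_le_half_trace[OF S] by blast
  obtain \<mu> where \<mu>: "\<mu> > 0" "\<And>p. p \<in> kerA_perp m N n \<Longrightarrow> psd_mat ?b (Aop m N n p) \<Longrightarrow>
    \<mu> * sqrt (pair_inner p p) \<le> mtrace (Aop m N n p * S)"
    using mtrace_Aop_coercive[OF S] by blast
  \<comment> \<open>With t = Tr(A(p) S), the half-trace bound gives J(p) \<ge> t/2 - c, so J(p)
    \<le> J(p1) implies t \<le> 2 * (J(p1) + c); coercivity turns this into a bound on the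
    norm.\<close>
  define R where "R = (2 * (?J p1 + c) / \<mu>)\<^sup>2"
  \<comment> \<open>All four conditions are closed. The determinant bound holds on the sublevel set
    because the trace term is nonnegative; it excludes singular limits and keeps the logarithm
    continuous.\<close>
  let ?P = "\<lambda>p. p \<in> kerA_perp m N n \<and> psd_mat ?b (Aop m N n p) \<and> exp (- ?J p1) \<le> det (Aop m N n p)
    \<and> pair_inner p p \<le> R"
  have LD: "p \<in> kerA_perp m N n" "p \<in> sym_pairs m N n" "pos_def_mat ?b (Aop m N n p)"
    "psd_mat ?b (Aop m N n p)" if "p \<in> Lplus m N n" for p
    using that kerA_perp_sym by (auto simp: Lplus_def pos_def_imp_psd)
  have sublevel: "?P p" if p: "p \<in> Lplus m N n" and le: "?J p \<le> ?J p1" for p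
  proof -
    note pD = LD[OF p]
    let ?t = "mtrace (Aop m N n p * S)"
    have t: "?t \<ge> 0" using trace_psd_mult(1)[OF pD(4) S] .
    have Jp: "?J p = ?t - ln (det (Aop m N n p))" by (rule J[OF pD(2)])
    have "- ?J p1 \<le> ln (det (Aop m N n p))" using le t Jp by simp
    then have "exp (- ?J p1) \<le> det (Aop m N n p)"
      using pos_def_mat_det_pos[OF pD(3)] by (simp add: ln_ge_iff)
    moreover have "\<mu> * sqrt (pair_inner p p) \<le> 2 * (?J p1 + c)"
      using \<mu>(2)[OF pD(1,4)] c[OF pD(3)] Jp le by argo
    then have "sqrt (pair_inner p p) \<le> 2 * (?J p1 + c) / \<mu>" using \<mu>(1) by (simp add: field_simps)
    then have "(sqrt (pair_inner p p))\<^sup>2 \<le> R"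
      unfolding R_def using pair_inner_self_entries(1)[OF pD(2)] by (intro power_mono) auto
    then have "pair_inner p p \<le> R" using pair_inner_self_entries(1)[OF pD(2)] by simp
    ultimately show ?thesis using pD by blast
  qed
  have in_L: "p \<in> Lplus m N n" if "?P p" for p
  proof -
    have "det (Aop m N n p) \<noteq> 0" using that exp_gt_zero[of "- ?J p1"] by linarith
    then show ?thesis using psd_mat_det_nonzero that by (simp add: Lplus_def)
  qed
  have car: "p \<in> carrier_mat ?a ?a \<times> carrier_mat ?b ?b" if "?P p" for p
    using sym_pairsD(1,2)[OF kerA_perp_sym[of p]] that by (auto simp: mem_Times_iff)
  have P1: "?P p1" using sublevel[OF p1] by simp
  have "\<exists>p \<in> carrier_mat ?a ?a \<times> carrier_mat ?b ?b. ?P p \<and>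
    (\<forall>q \<in> carrier_mat ?a ?a \<times> carrier_mat ?b ?b. ?P q \<longrightarrow> ?J p \<le> ?J q)"
  proof (rule mat_pair_attains_min[where R = "sqrt R"])
    show "closed {x. ?P (mat_pair ?a ?b x)}"
      by (rule closed_Collect_conj closed_kerA_perp closed_psd_mat cont_mat_Aop
          closed_Collect_le continuous_on_det continuous_on_pair_inner continuous_on_const)+
    have "continuous_on {x. ?P (mat_pair ?a ?b x)} (\<lambda>x. mtrace (Aop m N n (mat_pair ?a ?b x) * S)
        - ln (det (Aop m N n (mat_pair ?a ?b x))))"
    proof (intro continuous_on_diff continuous_on_ln)
      show "continuous_on {x. ?P (mat_pair ?a ?b x)} (\<lambda>x. mtrace (Aop m N n (mat_pair ?a ?b x) * S))"
        by (rule continuous_on_mtrace_Aop[OF Sc])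
      show "continuous_on {x. ?P (mat_pair ?a ?b x)} (\<lambda>x. det (Aop m N n (mat_pair ?a ?b x)))"
        by (rule continuous_on_subset[OF continuous_on_det[OF cont_mat_Aop]]) simp
      show "\<forall>x\<in>{x. ?P (mat_pair ?a ?b x)}. det (Aop m N n (mat_pair ?a ?b x)) \<noteq> 0"
      proof
        fix x assume "x \<in> {x. ?P (mat_pair ?a ?b x)}"
        then have "exp (- ?J p1) \<le> det (Aop m N n (mat_pair ?a ?b x))" by simp
        then show "det (Aop m N n (mat_pair ?a ?b x)) \<noteq> 0"
          using exp_gt_zero[of "- ?J p1"] by linarith
      qed
    qed
    then show "continuous_on {x. ?P (mat_pair ?a ?b x)} (\<lambda>x. ?J (mat_pair ?a ?b x))"
      using J[OF kerA_perp_sym] by (subst continuous_on_cong[OF refl]) auto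
    show "(i < ?a \<longrightarrow> j < ?a \<longrightarrow> \<bar>fst p $$ (i,j)\<bar> \<le> sqrt R) \<and>
      (i < ?b \<longrightarrow> j < ?b \<longrightarrow> \<bar>snd p $$ (i,j)\<bar> \<le> sqrt R)" if "?P p" for p i j
      using that by (intro pair_entries_bounded kerA_perp_sym) auto
    show "0 \<le> sqrt R" by (simp add: R_def)
  qed (use P1 car[OF P1] in auto)
  then obtain p where p: "?P p" "\<And>q. ?P q \<Longrightarrow> ?J p \<le> ?J q" using car by metis
  \<comment> \<open>Either q lies in the sublevel set, where p is minimal, or J(q) exceeds J(p1),
    which is at least J(p).\<close>
  have "?J p \<le> ?J q" if q: "q \<in> Lplus m N n" for q
  proof (cases "?J q \<le> ?J p1")
    case True
    then show ?thesis using p(2)[OF sublevel[OF q]] by simp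
  next
    case False
    then show ?thesis using p(2)[OF P1] by simp
  qed
  then show ?thesis using in_L[OF p(1)] by blast
qed

text \<open>At the midpoint of two distinct minimisers the trace term is the average, while log det
  exceeds the average strictly, because distinct pairs in the complement have distinct images. The
  functional would be smaller there than its minimum.\<close>

lemma Lplus_minimum_unique:
  assumes S: "S \<in> carrier_mat (m*N) (m*N)"
    and J: "\<And>p. p \<in> sym_pairs m N n \<Longrightarrow> Jfun m N n \<Sigma> p = mtrace (Aop m N n p * S) - ln (det (Aop m N n p))"
    and p: "p \<in> Lplus m N n" and q: "q \<in> Lplus m N n"
    and pmin: "\<And>r. r \<in> Lplus m N n \<Longrightarrow> Jfun m N n \<Sigma> p \<le> Jfun m N n \<Sigma> r"
    and qmin: "\<And>r. r \<in> Lplus m N n \<Longrightarrow> Jfun m N n \<Sigma> q \<le> Jfun m N n \<Sigma> r"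
  shows "p = q"
proof (rule ccontr)
  assume "p \<noteq> q"
  let ?b = "m*N" and ?r = "pair_comb (1/2) p (1/2) q"
  let ?M = "Aop m N n p" and ?K = "Aop m N n q"
  have pp: "p \<in> kerA_perp m N n" "pos_def_mat ?b ?M" and qp: "q \<in> kerA_perp m N n" "pos_def_mat ?b ?K"
    using p q by (auto simp: Lplus_def)
  note ps = kerA_perp_sym[OF pp(1)] and qs = kerA_perp_sym[OF qp(1)]
  note A = Aop_carrier(1)[OF ps] Aop_carrier(1)[OF qs]
  have Ar: "Aop m N n ?r = (1/2) \<cdot>\<^sub>m (?M + ?K)"
    unfolding Aop_comb[OF ps qs] using A by (intro eq_matI) (auto simp: field_simps)
  have "?r \<in> Lplus m N n"
    unfolding Lplus_def using pair_comb_perp[OF pp(1) qp(1)] pp(2) qp(2)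
    by (auto simp: Ar intro: pos_def_mat_smult pos_def_mat_add)
  from pmin[OF this] qmin[OF this]
  have "Jfun m N n \<Sigma> p + Jfun m N n \<Sigma> q \<le> 2 * Jfun m N n \<Sigma> ?r" by simp
  then have "(mtrace (?M * S) - ln (det ?M)) + (mtrace (?K * S) - ln (det ?K))
      \<le> 2 * (mtrace (Aop m N n ?r * S) - ln (det (Aop m N n ?r)))"
    unfolding J[OF ps] J[OF qs] J[OF pair_comb_sym[OF ps qs]] .
  moreover have "mtrace (Aop m N n ?r * S) = (mtrace (?M * S) + mtrace (?K * S)) / 2"
    unfolding Ar using A S
    by (simp add: mult_smult_assoc_mat[of _ ?b ?b _ ?b] add_mult_distrib_mat[of _ ?b ?b _ _ ?b]
        mtrace_linear[of _ ?b])
  moreover have "ln (det ?M) + ln (det ?K) < 2 * ln (det (Aop m N n ?r))"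
    unfolding Ar using ln_det_midpoint_less[OF pp(2) qp(2)] Aop_inj_on_perp[OF pp(1) qp(1)] \<open>p \<noteq> q\<close>
    by blast
  ultimately show False by argo
qed

theorem theorem6:
  fixes m n N :: nat and \<Sigma> :: "nat \<Rightarrow> real mat"
  assumes "m \<ge> 1" and "n \<ge> 1" and "N > 2*n"
    and "\<And>k. k \<le> n \<Longrightarrow> \<Sigma> k \<in> carrier_mat m m"
    and "\<exists>S. pos_def_mat (m*N) S
            \<and> (Emat m N n)\<^sup>T * S * Emat m N n = Tmat m n \<Sigma>
            \<and> (Umat m N)\<^sup>T * S * Umat m N = S"
  shows "\<exists>!p. p \<in> Lplus m N n \<and> (\<forall>q \<in> Lplus m N n. Jfun m N n \<Sigma> p \<le> Jfun m N n \<Sigma> q)"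
proof -
  obtain S where S: "pos_def_mat (m*N) S" "(Emat m N n)\<^sup>T * S * Emat m N n = Tmat m n \<Sigma>"
    "(Umat m N)\<^sup>T * S * Umat m N = S" using assms(5) by blast
  have Sc: "S \<in> carrier_mat (m*N) (m*N)" using S(1) by (simp add: pos_def_mat_def)
  have J: "Jfun m N n \<Sigma> p = mtrace (Aop m N n p * S) - ln (det (Aop m N n p))"
    if "p \<in> sym_pairs m N n" for p
    unfolding Jfun_def mtrace_Tmat[OF that Sc S(2,3)] ..
  \<comment> \<open>From \<open>n \<ge> 1\<close> and \<open>N > 2*n\<close> follow n + 1 \<le> N
    and N \<ge> 2, as the explicit preimage of the identity requires.\<close>
  have "\<exists>p. p \<in> Lplus m N n" using assms(1-3) by (intro Lplus_nonempty) auto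
  from Lplus_minimum_exists[OF S(1) this J]
  obtain p where "p \<in> Lplus m N n" "\<forall>q \<in> Lplus m N n. Jfun m N n \<Sigma> p \<le> Jfun m N n \<Sigma> q" by blast
  then show ?thesis using Lplus_minimum_unique[OF Sc J] by blast
qed

end
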